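(* Let $d\ge1$, $s\in(0,1)$ and $\beta=\frac1{d+2(2+s)}$. Consider, for $A>0$ and $a>0$, the function $$V(y):=(A-a|y|^2)_+^{2+s},\qquad y\in\mathbb{R}^d,$$ which is positive in the ball $B_R=B_R(0)$ with $R=(A/a)^{1/2}$. There exists $a=a(d,s)$ such that $V$ solves the problem $$(-\Delta)^s(-\Delta)V=C-\frac\beta2|y|^2\ \text{ in }B_R,\qquad V=0\ \text{ in }\mathbb{R}^d\setminus B_R .$$ The precise value of $a$ is given by $$a^{-(2+s)}=2(2+s)(d+4+2s)\,\gamma_{s,d}\,\mu_{s,d}\,\kappa_{s,d}.$$ $A>0$ is a free constant, and $C=c(s,d)\,A$ with $$c(s,d)=\frac{\beta}{2a\gamma_{s,d}}\left(1-\frac{4(1+s)}{\kappa_{s,d}\,(2d+4(1+s))}\right).$$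
   Context: $(-\Delta)^s$ is the fractional Laplacian on $\mathbb{R}^d$ (Fourier multiplier $|\xi|^{2s}$), $\Delta$ is the usual Laplacian, $\Gamma$ is the Euler Gamma function and $(\cdot)_+$ denotes the positive part. The constants are $\gamma_{s,d}=1+\frac{2s}d$, $\mu_{s,d}=2d+4(1+s)$ and $\kappa_{s,d}=2^{2s}\Gamma(s+2)\Gamma(s+\frac d2)\Gamma(\frac d2)^{-1}$.
   Formalization: The printed c(s,d) is false unless κ_{s,d}=1+s (e.g. d=2, s=1/2 gives κ=3π/4); the formal statement uses c(s,d)=β/(2aγ_{s,d})·(1−4/(2d+4(1+s))), since (−Δ)^s(1−|y|²)_+^s=κ_{s,d}/(1+s) in the unit ball, not 1. *)

theory Defs
  imports "HOL-Analysis.Analysis"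
begin

definition gamma_const :: "real \<Rightarrow> nat \<Rightarrow> real" where
  "gamma_const s d = 1 + 2 * s / real d"

definition mu_const :: "real \<Rightarrow> nat \<Rightarrow> real" where
  "mu_const s d = 2 * real d + 4 * (1 + s)"

definition kappa_const :: "real \<Rightarrow> nat \<Rightarrow> real" where
  "kappa_const s d =
     2 powr (2 * s) * Gamma (s + 2) * Gamma (s + real d / 2) / Gamma (real d / 2)"

definition beta_const :: "real \<Rightarrow> nat \<Rightarrow> real" where
  "beta_const s d = 1 / (real d + 2 * (2 + s))"

(* The source prints the fraction in the last factor as
     4 (1 + s) / (kappa (2 d + 4 (1 + s))).
   With u = (1 - |y|^2)_+ one has, inside the unit ball,
     - Laplacian (u^(2+s)) = (2 + s) (mu u^(1+s) - 4 (1 + s) u^s),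
     (-Laplacian)^s (u^(1+s)) = kappa (1 - gamma |y|^2),
     (-Laplacian)^s (u^s) = kappa / (1 + s),
   hence (-Laplacian)^s (-Laplacian) (u^(2+s)) = (2 + s) kappa (mu - 4 - mu gamma |y|^2).
   So the fraction must be 4 (1 + s) (kappa / (1 + s)) / (kappa mu) = 4 / mu; the
   printed value takes (-Laplacian)^s (u^s) = 1 and agrees only if kappa = 1 + s. *)
definition c_const :: "real \<Rightarrow> nat \<Rightarrow> real \<Rightarrow> real" where
  "c_const s d a =
     beta_const s d / (2 * a * gamma_const s d) * (1 - 4 / (2 * real d + 4 * (1 + s)))"

(* The exponent 2 + s is positive, so 0 powr (2 + s) = 0 is the intended value
   outside the ball. *)
definition V_profile :: "real \<Rightarrow> real \<Rightarrow> real \<Rightarrow> 'a::euclidean_space \<Rightarrow> real" where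
  "V_profile s A a y = (max 0 (A - a * (norm y)\<^sup>2)) powr (2 + s)"

definition laplacian :: "('a::euclidean_space \<Rightarrow> real) \<Rightarrow> 'a \<Rightarrow> real" where
  "laplacian f x = (\<Sum>b\<in>Basis. (deriv ^^ 2) (\<lambda>t. f (x + t *\<^sub>R b)) 0)"

definition fourier :: "('a::euclidean_space \<Rightarrow> real) \<Rightarrow> 'a \<Rightarrow> complex" where
  "fourier f \<xi> = (\<integral>x. of_real (f x) * cis (- (\<xi> \<bullet> x)) \<partial>lborel)"

(* (-Laplacian)^s f = g as the Fourier multiplier |xi|^(2 s), for f and g in L^1.
   Since the Fourier transform is injective on L^1, f determines g up to a null set. *)
definition has_frac_laplacian ::
    "real \<Rightarrow> ('a::euclidean_space \<Rightarrow> real) \<Rightarrow> ('a \<Rightarrow> real) \<Rightarrow> bool" where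
  "has_frac_laplacian s f g \<longleftrightarrow>
     integrable lborel f \<and> integrable lborel g \<and>
     (\<forall>\<xi>. fourier g \<xi> = of_real (norm \<xi> powr (2 * s)) * fourier f \<xi>)"

(* (-Laplacian)^s (-Laplacian) V is only determined almost everywhere, and it is
   unbounded near the sphere |y| = R, so the equation in the open ball is stated for a
   suitable representative W.  That is equality almost everywhere in the ball, and
   everywhere for the continuous representative there. *)
definition solves_profile_problem ::
    "real \<Rightarrow> real \<Rightarrow> real \<Rightarrow> ('a::euclidean_space \<Rightarrow> real) \<Rightarrow> bool" where
  "solves_profile_problem s R C V \<longleftrightarrow>
     (\<exists>W. has_frac_laplacian s (\<lambda>y. - laplacian V y) W \<and>
          (\<forall>y\<in>ball 0 R. W y = C - beta_const s DIM('a) / 2 * (norm y)\<^sup>2)) \<and>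
     (\<forall>y. y \<notin> ball 0 R \<longrightarrow> V y = 0)"

end

theory Submission
  imports Defs "HOL-Probability.Probability" "HOL-Real_Asymp.Real_Asymp"
begin

text \<open>
  For \<open>q \<ge> 0\<close> and \<open>b = d/2\<close> write \<open>P(r, l)(x) = (l - |x|^2)_+^r\<close>. The function
  \<open>g_l = C \<integral>_0^\<infinity> (P(q, l) - (1 + t)^(-b-q) P(q, l(1+t))) t^(-1-s) dt\<close>, a Marchaud derivative in
  the squared radius, is the fractional Laplacian of \<open>P(q+s, l)\<close>: at a fixed frequency \<open>\<xi>\<close> both
  sides are continuous in \<open>l\<close>, and their Laplace transforms in \<open>l\<close> agree, because the Laplace
  transform of \<open>P(r, l)(x)\<close> is a Gaussian in \<open>x\<close> and
  \<open>\<integral>_0^\<infinity> (1 - e^(-ct)) t^(-1-s) dt = c^s \<Gamma>(1 - s) / s\<close> with \<open>c = |\<xi>|^2 / (4p)\<close>.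
  Inside the ball the integrals for \<open>q = 0\<close> and \<open>q = 1\<close> are Beta integrals, and
  \<open>-\<Delta> V\<close> is a linear combination of \<open>P(1+s, l)\<close> and \<open>P(s, l)\<close> with \<open>l = A/a\<close>.
\<close>

section \<open>Marchaud-type integrals\<close>

text \<open>The formula for \<open>g_l\<close> comes from the action of the multiplier on a
  Gaussian. The transform of \<open>exp (- p |x|^2)\<close> is a constant times
  \<open>exp (- c)\<close> with \<open>c\<close> as above, and multiplying by
  \<open>|\<xi>|^(2s)\<close> amounts, up to a constant and a factor \<open>p^s\<close>, to
  integrating \<open>exp (- c) - exp (- c (1 + t))\<close> against \<open>t^(-1-s)\<close>. The
  second exponential belongs to the Gaussian with \<open>p / (1 + t)\<close> in place of
  \<open>p\<close>, and on the side of \<open>l\<close> this is the dilation to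
  \<open>l (1 + t)\<close>. So a singular integral over space becomes an integral in one real
  variable \<open>t\<close>, whose integrand is elementary inside the ball. The obstacle is the
  sphere: for \<open>q = 0\<close> the function \<open>g_l\<close> blows up when the sphere is
  approached from outside. Estimates are therefore made in \<open>L^1\<close>, where the kernel
  \<open>t^(-1-s)\<close> requires a gain as \<open>t\<close> tends to 0. Comparing total masses of
  two truncated powers supplies it, since these are ordered pointwise.\<close>

lemma nn_integral_powr_exp:
  fixes a c :: real
  assumes "a > 0" "c > 0"
  shows "(\<integral>\<^sup>+t. ennreal (indicator {0<..} t * (t powr (a - 1) * exp (- c * t))) \<partial>lborel)
    = ennreal (Gamma a * c powr - a)"
proof -
  have "Gamma a = (\<integral>\<^sup>+t. ennreal (indicator {0..} t * t powr (a - 1) / exp t) \<partial>lborel)"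
    using Gamma_conv_nn_integral_real[OF assms(1)] by simp
  also have "\<dots> = (\<integral>\<^sup>+t. ennreal (indicator {0<..} t * t powr (a - 1) / exp t) \<partial>lborel)"
    by (intro nn_integral_cong_AE) (use AE_lborel_singleton[of "0::real"] in \<open>eventually_elim; auto simp: indicator_def\<close>)
  also have "\<dots> = \<bar>c\<bar> * (\<integral>\<^sup>+t. ennreal (indicator {0<..} (0 + c * t) * (0 + c * t) powr (a - 1) / exp (0 + c * t)) \<partial>lborel)"
    by (rule nn_integral_real_affine) (use assms in auto)
  also have "\<dots> = ennreal c * (\<integral>\<^sup>+t. ennreal (c powr (a - 1)) * ennreal (indicator {0<..} t * (t powr (a - 1) * exp (- c * t))) \<partial>lborel)"
    using assms
    by (auto intro!: nn_integral_cong simp: ennreal_mult[symmetric] indicator_def zero_less_mult_iff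
        powr_mult exp_minus field_simps)
  also have "\<dots> = ennreal c * (ennreal (c powr (a - 1)) * (\<integral>\<^sup>+t. ennreal (indicator {0<..} t * (t powr (a - 1) * exp (- c * t))) \<partial>lborel))"
    by (subst nn_integral_cmult) auto
  also have "\<dots> = ennreal (c powr a) * (\<integral>\<^sup>+t. ennreal (indicator {0<..} t * (t powr (a - 1) * exp (- c * t))) \<partial>lborel)"
    using assms by (simp add: mult.assoc[symmetric] ennreal_mult[symmetric] powr_diff)
  finally have "ennreal (c powr - a) * Gamma a = ennreal (c powr - a) * (ennreal (c powr a) * (\<integral>\<^sup>+t. ennreal (indicator {0<..} t * (t powr (a - 1) * exp (- c * t))) \<partial>lborel))"
    by simp
  also have "\<dots> = (\<integral>\<^sup>+t. ennreal (indicator {0<..} t * (t powr (a - 1) * exp (- c * t))) \<partial>lborel)"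
    using assms by (simp add: mult.assoc[symmetric] ennreal_mult[symmetric] powr_minus)
  finally show ?thesis
    using assms by (simp add: ennreal_mult[symmetric] Gamma_real_nonneg mult.commute)
qed

lemma nn_integral_powr_tail:
  fixes s y :: real
  assumes "s > 0" "y > 0"
  shows "(\<integral>\<^sup>+t. ennreal (indicator {y<..} t * t powr (- 1 - s)) \<partial>lborel) = ennreal (y powr - s / s)"
proof -
  have "(\<integral>\<^sup>+t. ennreal (t powr (- 1 - s)) * indicator {y..} t \<partial>lborel) = 0 - (- (y powr - s / s))"
  proof (rule nn_integral_FTC_atLeast)
    have [simp]: "- s - 1 = - 1 - s" by simp
    show "DERIV (\<lambda>t. - (t powr - s / s)) x :> x powr (- 1 - s)" if "y \<le> x" for x
      using that assms by (auto intro!: derivative_eq_intros simp: field_simps)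
    show "((\<lambda>t. - (t powr - s / s)) \<longlongrightarrow> 0) at_top"
      using assms by real_asymp
  qed (use assms in auto)
  also have "(\<integral>\<^sup>+t. ennreal (t powr (- 1 - s)) * indicator {y..} t \<partial>lborel) = (\<integral>\<^sup>+t. ennreal (indicator {y<..} t * t powr (- 1 - s)) \<partial>lborel)"
    by (intro nn_integral_cong_AE) (use AE_lborel_singleton[of y] in \<open>eventually_elim; auto simp: indicator_def\<close>)
  finally show ?thesis by simp
qed

text \<open>Since \<open>1 - exp (- c * t)\<close> is the integral of
  \<open>c * exp (- c * y)\<close> over \<open>0 < y < t\<close>, Tonelli applies: the tail integral
  of \<open>t powr (- 1 - s)\<close> over \<open>t > y\<close> contributes
  \<open>y powr - s / s\<close>, and a Gamma integral with exponent \<open>1 - s\<close>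
  remains.\<close>

lemma nn_integral_exp_Marchaud:
  fixes s c :: real
  assumes "0 < s" "s < 1" "c \<ge> 0"
  shows "(\<integral>\<^sup>+t. ennreal (indicator {0<..} t * ((1 - exp (- c * t)) * t powr (- 1 - s))) \<partial>lborel)
    = ennreal (c powr s * Gamma (1 - s) / s)"
proof (cases "c = 0")
  case True
  then show ?thesis by simp
next
  case False
  with assms have c: "c > 0" by simp
  have 1: "ennreal (indicator {0<..} t * ((1 - exp (- c * t)) * t powr (- 1 - s))) =
      (\<integral>\<^sup>+y. ennreal (indicator {0<..} y * (c * exp (- c * y))) * ennreal (indicator {y<..} t * t powr (- 1 - s)) \<partial>lborel)" for t
  proof (cases "t > 0")
    case True
    have "(\<integral>\<^sup>+y. ennreal (c * exp (- c * y)) * indicator {0..t} y \<partial>lborel) = (- exp (- c * t)) - (- exp (- c * 0))"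
      by (rule nn_integral_FTC_Icc) (use True c in \<open>auto intro!: derivative_eq_intros\<close>)
    also have "(\<integral>\<^sup>+y. ennreal (c * exp (- c * y)) * indicator {0..t} y \<partial>lborel) = (\<integral>\<^sup>+y. ennreal (indicator {0<..} y * (c * exp (- c * y))) * indicator {..<t} y \<partial>lborel)"
      by (intro nn_integral_cong_AE)
        (use AE_lborel_singleton[of 0] AE_lborel_singleton[of t] in \<open>eventually_elim; auto simp: indicator_def\<close>)
    finally have *: "(\<integral>\<^sup>+y. ennreal (indicator {0<..} y * (c * exp (- c * y))) * indicator {..<t} y \<partial>lborel) = ennreal (1 - exp (- c * t))"
      by simp
    have "(\<integral>\<^sup>+y. ennreal (indicator {0<..} y * (c * exp (- c * y))) * ennreal (indicator {y<..} t * t powr (- 1 - s)) \<partial>lborel)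
       = (\<integral>\<^sup>+y. ennreal (indicator {0<..} y * (c * exp (- c * y))) * indicator {..<t} y * ennreal (t powr (- 1 - s)) \<partial>lborel)"
      by (intro nn_integral_cong) (auto simp: indicator_def)
    also have "\<dots> = ennreal (1 - exp (- c * t)) * ennreal (t powr (- 1 - s))"
      by (subst nn_integral_multc) (simp_all only: *, auto)
    finally show ?thesis using True c
      by (simp add: ennreal_mult)
  next
    case False
    then have "(\<lambda>y. ennreal (indicator {0<..} y * (c * exp (- c * y))) * ennreal (indicator {y<..} t * t powr (- 1 - s))) = (\<lambda>y. 0)"
      by (auto simp: indicator_def)
    with False show ?thesis by simp
  qed
  have "(\<integral>\<^sup>+t. ennreal (indicator {0<..} t * ((1 - exp (- c * t)) * t powr (- 1 - s))) \<partial>lborel)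
     = (\<integral>\<^sup>+y. (\<integral>\<^sup>+t. ennreal (indicator {0<..} y * (c * exp (- c * y))) * ennreal (indicator {y<..} t * t powr (- 1 - s)) \<partial>lborel) \<partial>lborel)"
    unfolding 1 by (rule lborel_pair.Fubini') (simp add: greaterThan_def split_beta)
  also have "\<dots> = (\<integral>\<^sup>+y. ennreal (indicator {0<..} y * (c * exp (- c * y))) * (\<integral>\<^sup>+t. ennreal (indicator {y<..} t * t powr (- 1 - s)) \<partial>lborel) \<partial>lborel)"
    by (subst nn_integral_cmult) auto
  also have "\<dots> = (\<integral>\<^sup>+y. ennreal (c / s) * ennreal (indicator {0<..} y * (y powr ((1 - s) - 1) * exp (- c * y))) \<partial>lborel)"
  proof (intro nn_integral_cong, goal_cases)
    case (1 y)
    show ?case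
      using assms c nn_integral_powr_tail[of s y]
      by (cases "y > 0") (simp_all add: ennreal_mult[symmetric] mult_ac)
  qed
  also have "\<dots> = ennreal (c / s) * ennreal (Gamma (1 - s) * c powr - (1 - s))"
    by (subst nn_integral_cmult) (use assms c nn_integral_powr_exp[of "1 - s" c] in simp_all)
  also have "\<dots> = ennreal (c powr s * Gamma (1 - s) / s)"
    using assms c by (simp add: ennreal_mult[symmetric] Gamma_real_nonneg powr_minus powr_diff field_simps)
  finally show ?thesis .
qed

text \<open>\<open>Gamma b * (1 - (1 + t) powr - b)\<close> is the integral of
  \<open>y powr (b - 1) * exp (- y) * (1 - exp (- y * t))\<close> over \<open>y > 0\<close>, so
  Tonelli reduces the claim to \<open>nn_integral_exp_Marchaud\<close> with \<open>c = y\<close>.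
  The factor \<open>y powr s\<close> obtained there shifts the Gamma integral from \<open>b\<close>
  to \<open>b + s\<close>.\<close>

lemma nn_integral_powr_Marchaud:
  fixes s b :: real
  assumes "0 < s" "s < 1" "b > 0"
  shows "(\<integral>\<^sup>+t. ennreal (indicator {0<..} t * ((1 - (1 + t) powr - b) * t powr (- 1 - s))) \<partial>lborel)
    = ennreal (Gamma (b + s) * Gamma (1 - s) / (s * Gamma b))"
proof -
  define G where "G = Gamma b"
  have G: "G > 0" using assms by (simp add: G_def)
  have 1: "ennreal (indicator {0<..} t * ((1 - (1 + t) powr - b) * t powr (- 1 - s))) =
      (\<integral>\<^sup>+y. ennreal (1 / G) * ennreal (indicator {0<..} y * (y powr (b - 1) * exp (- 1 * y))) *
        ennreal (indicator {0<..} t * ((1 - exp (- y * t)) * t powr (- 1 - s))) \<partial>lborel)" for t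
  proof (cases "t > 0")
    case True
    let ?k = "\<lambda>y. indicator {0<..} y * (y powr (b - 1) * exp (- 1 * y))"
    let ?l = "\<lambda>y. indicator {0<..} y * (y powr (b - 1) * exp (- (1 + t) * y))"
    have "(\<integral>\<^sup>+y. ennreal (?k y - ?l y) \<partial>lborel) = (\<integral>\<^sup>+y. ennreal (?k y) \<partial>lborel) - (\<integral>\<^sup>+y. ennreal (?l y) \<partial>lborel)"
      using True nn_integral_powr_exp[of b "1 + t"] assms
      by (subst nn_integral_diff[symmetric])
        (auto simp: ennreal_minus indicator_def algebra_simps intro!: mult_left_mono AE_I2 ennreal_leI nn_integral_cong)
    also have "\<dots> = ennreal (G * (1 - (1 + t) powr - b))"
      using nn_integral_powr_exp[of b "1"] nn_integral_powr_exp[of b "1 + t"] assms True G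
      by (simp add: G_def ennreal_minus right_diff_distrib)
    finally have *: "(\<integral>\<^sup>+y. ennreal (?k y - ?l y) \<partial>lborel) = ennreal (G * (1 - (1 + t) powr - b))" .
    have "(\<integral>\<^sup>+y. ennreal (1 / G) * ennreal (indicator {0<..} y * (y powr (b - 1) * exp (- 1 * y))) *
        ennreal (indicator {0<..} t * ((1 - exp (- y * t)) * t powr (- 1 - s))) \<partial>lborel)
       = (\<integral>\<^sup>+y. ennreal (t powr (- 1 - s) / G) * ennreal (?k y - ?l y) \<partial>lborel)"
    proof (intro nn_integral_cong, goal_cases)
      case (1 y)
      then show ?case
      proof (cases "y > 0")
        case y: True
        then have "?k y - ?l y = y powr (b - 1) * exp (- y) * (1 - exp (- y * t))"
          by (simp add: algebra_simps exp_add[symmetric])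
        then show ?thesis
          using y True G by (simp add: ennreal_mult[symmetric] mult_ac)
      qed auto
    qed
    also have "\<dots> = ennreal (t powr (- 1 - s) / G) * ennreal (G * (1 - (1 + t) powr - b))"
      by (subst nn_integral_cmult) (simp_all only: *, auto)
    also have "\<dots> = ennreal ((t powr (- 1 - s) / G) * (G * (1 - (1 + t) powr - b)))"
      using G by (subst ennreal_mult'[symmetric]) auto
    finally show ?thesis using True G
      by (simp add: mult.commute)
  qed (auto)
  have "(\<integral>\<^sup>+t. ennreal (indicator {0<..} t * ((1 - (1 + t) powr - b) * t powr (- 1 - s))) \<partial>lborel)
     = (\<integral>\<^sup>+y. (\<integral>\<^sup>+t. ennreal (1 / G) * ennreal (indicator {0<..} y * (y powr (b - 1) * exp (- 1 * y))) *
        ennreal (indicator {0<..} t * ((1 - exp (- y * t)) * t powr (- 1 - s))) \<partial>lborel) \<partial>lborel)"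
    unfolding 1 by (rule lborel_pair.Fubini') (simp add: split_beta)
  also have "\<dots> = (\<integral>\<^sup>+y. ennreal (1 / G) * ennreal (indicator {0<..} y * (y powr (b - 1) * exp (- 1 * y))) *
       (\<integral>\<^sup>+t. ennreal (indicator {0<..} t * ((1 - exp (- y * t)) * t powr (- 1 - s))) \<partial>lborel) \<partial>lborel)"
    by (subst nn_integral_cmult) auto
  also have "\<dots> = (\<integral>\<^sup>+y. ennreal (Gamma (1 - s) / (s * G)) * ennreal (indicator {0<..} y * (y powr ((b + s) - 1) * exp (- 1 * y))) \<partial>lborel)"
  proof (intro nn_integral_cong, goal_cases)
    case (1 y)
    have "y > 0 \<Longrightarrow> y powr (b + s - 1) = y powr s * y powr (b - 1)"
      by (simp add: powr_add[symmetric] add.commute algebra_simps)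
    then show ?case
      using assms G nn_integral_exp_Marchaud[of s y]
      by (cases "y > 0") (simp_all add: ennreal_mult[symmetric] mult_ac Gamma_real_nonneg)
  qed
  also have "\<dots> = ennreal (Gamma (1 - s) / (s * G)) * ennreal (Gamma (b + s) * 1 powr - (b + s))"
    by (subst nn_integral_cmult) (use assms nn_integral_powr_exp[of "b + s" 1] in simp_all)
  also have "\<dots> = ennreal (Gamma (b + s) * Gamma (1 - s) / (s * Gamma b))"
    using assms by (simp add: ennreal_mult[symmetric] Gamma_real_nonneg G_def mult_ac)
  finally show ?thesis .
qed

section \<open>Fourier transforms of Gaussians and truncated powers\<close>

lemma fourier_gaussian_real:
  fixes p \<xi> :: real
  assumes "p > 0"
  shows "integrable lborel (\<lambda>x::real. complex_of_real (exp (- p * x\<^sup>2)) * cis (- (\<xi> * x)))"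
    and "(\<integral>x. complex_of_real (exp (- p * x\<^sup>2)) * cis (- (\<xi> * x)) \<partial>lborel)
      = of_real (sqrt (pi / p) * exp (- \<xi>\<^sup>2 / (4 * p)))"
proof -
  \<comment> \<open>The scaling \<open>y = c * x\<close> turns \<open>p * x^2\<close> into
    \<open>y^2 / 2\<close>, which brings in the characteristic function of the standard normal
    law.\<close>
  define c where "c = sqrt (2 * p)"
  have c: "c > 0" "c\<^sup>2 = 2 * p" using assms by (auto simp: c_def)
  define h where "h = (\<lambda>x. std_normal_density x *\<^sub>R cis (- (\<xi> / c) * x))"
  have [measurable]: "(\<lambda>x. cis (- (\<xi> * x / c))) \<in> borel_measurable borel"
    using c by (intro borel_measurable_continuous_onI continuous_intros) auto
  have int_h: "integrable lborel h"
    unfolding h_def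
    by (rule Bochner_Integration.integrable_bound[OF integrable_normal_density[of 1 0]]) auto
  have "char std_normal_distribution (- (\<xi> / c)) = (\<integral>x. h x \<partial>lborel)"
    unfolding char_def h_def
    by (subst integral_density) (auto simp: cis_conv_exp normal_density_nonneg)
  then have val_h: "(\<integral>x. h x \<partial>lborel) = of_real (exp (- \<xi>\<^sup>2 / (4 * p)))"
    using c by (simp add: char_std_normal_distribution power_divide)
  have eq: "complex_of_real (exp (- p * x\<^sup>2)) * cis (- (\<xi> * x)) = sqrt (2 * pi) *\<^sub>R h (0 + c * x)" for x
    using c by (simp add: h_def std_normal_density_def power_mult_distrib scaleR_conv_of_real)
  show "integrable lborel (\<lambda>x::real. complex_of_real (exp (- p * x\<^sup>2)) * cis (- (\<xi> * x)))"
    unfolding eq using c by (intro integrable_scaleR_right lborel_integrable_real_affine int_h) auto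
  have "(\<integral>x. complex_of_real (exp (- p * x\<^sup>2)) * cis (- (\<xi> * x)) \<partial>lborel)
      = sqrt (2 * pi) *\<^sub>R (\<integral>x. h (0 + c * x) \<partial>lborel)"
    unfolding eq by (rule integral_scaleR_right)
  also have "(\<integral>x. h (0 + c * x) \<partial>lborel) = (1 / c) *\<^sub>R (\<integral>x. h x \<partial>lborel)"
    using c by (subst lborel_integral_real_affine[where f = h and c = c and t = 0]) auto
  also have "sqrt (2 * pi) *\<^sub>R ((1 / c) *\<^sub>R (\<integral>x. h x \<partial>lborel)) = of_real (sqrt (pi / p) * exp (- \<xi>\<^sup>2 / (4 * p)))"
    using assms by (simp add: val_h c_def real_sqrt_divide real_sqrt_mult scaleR_conv_of_real)
  finally show "(\<integral>x. complex_of_real (exp (- p * x\<^sup>2)) * cis (- (\<xi> * x)) \<partial>lborel)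
      = of_real (sqrt (pi / p) * exp (- \<xi>\<^sup>2 / (4 * p)))" .
qed

text \<open>Fubini for tensor products, with \<open>lborel\<close> seen as the image of the product
  of the coordinate measures; it reduces the Gaussian to dimension one.\<close>

lemma lborel_prod_Basis:
  fixes f :: "'a::euclidean_space \<Rightarrow> real \<Rightarrow> complex"
  assumes f: "\<And>b. b \<in> Basis \<Longrightarrow> integrable lborel (f b)"
  shows "integrable lborel (\<lambda>x::'a. \<Prod>b\<in>Basis. f b (x \<bullet> b))"
    and "(\<integral>x. (\<Prod>b\<in>Basis. f b (x \<bullet> b)) \<partial>(lborel :: 'a measure)) = (\<Prod>b\<in>Basis. \<integral>x. f b x \<partial>lborel)"
proof -
  interpret product_sigma_finite "\<lambda>_::'a. lborel :: real measure" ..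
  have [measurable]: "\<And>b. b \<in> Basis \<Longrightarrow> f b \<in> borel_measurable borel"
    using f by (auto dest: borel_measurable_integrable)
  have eq: "(\<lambda>g. \<Prod>b\<in>Basis. f b ((\<Sum>b\<in>Basis. g b *\<^sub>R b) \<bullet> b)) = (\<lambda>g::'a \<Rightarrow> real. \<Prod>b\<in>Basis. f b (g b))"
    by (intro ext prod.cong) auto
  show "integrable lborel (\<lambda>x::'a. \<Prod>b\<in>Basis. f b (x \<bullet> b))"
    unfolding lborel_eq[where 'a='a]
    by (subst integrable_distr_eq) (auto simp: eq intro!: product_integrable_prod f)
  have "(\<integral>x. (\<Prod>b\<in>Basis. f b (x \<bullet> b)) \<partial>(lborel :: 'a measure)) = (\<integral>g. (\<Prod>b\<in>Basis. f b (g b)) \<partial>(\<Pi>\<^sub>M b\<in>Basis. lborel))"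
    unfolding lborel_eq[where 'a='a]
    by (subst integral_distr) (auto simp: eq)
  also have "\<dots> = (\<Prod>b\<in>Basis. \<integral>x. f b x \<partial>lborel)"
    by (rule product_integral_prod) (auto intro: f)
  finally show "(\<integral>x. (\<Prod>b\<in>Basis. f b (x \<bullet> b)) \<partial>(lborel :: 'a measure)) = (\<Prod>b\<in>Basis. \<integral>x. f b x \<partial>lborel)" .
qed

lemma fourier_gaussian:
  fixes \<xi> :: "'a::euclidean_space"
  assumes "p > 0"
  shows "integrable lborel (\<lambda>x::'a. complex_of_real (exp (- p * (norm x)\<^sup>2)) * cis (- (\<xi> \<bullet> x)))"
    and "fourier (\<lambda>x::'a. exp (- p * (norm x)\<^sup>2)) \<xi>
      = of_real ((pi / p) powr (real DIM('a) / 2) * exp (- (norm \<xi>)\<^sup>2 / (4 * p)))"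
proof -
  have sq: "(norm y)\<^sup>2 = (\<Sum>b\<in>Basis. (y \<bullet> b)\<^sup>2)" for y :: 'a
    by (simp only: power2_norm_eq_inner euclidean_inner[of y y]) (simp add: power2_eq_square)
  have eq: "complex_of_real (exp (- p * (norm x)\<^sup>2)) * cis (- (\<xi> \<bullet> x))
      = (\<Prod>b\<in>Basis. complex_of_real (exp (- p * (x \<bullet> b)\<^sup>2)) * cis (- ((\<xi> \<bullet> b) * (x \<bullet> b))))" for x :: 'a
    unfolding sq euclidean_inner[of \<xi> x]
    by (simp add: prod.distrib cis_conv_exp exp_of_real exp_sum sum_distrib_left sum_negf[symmetric])
  show "integrable lborel (\<lambda>x::'a. complex_of_real (exp (- p * (norm x)\<^sup>2)) * cis (- (\<xi> \<bullet> x)))"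
    unfolding eq by (intro lborel_prod_Basis(1) fourier_gaussian_real assms)
  have "fourier (\<lambda>x::'a. exp (- p * (norm x)\<^sup>2)) \<xi>
      = (\<Prod>b\<in>Basis. of_real (sqrt (pi / p) * exp (- (\<xi> \<bullet> b)\<^sup>2 / (4 * p))))"
    unfolding fourier_def eq
    by (subst lborel_prod_Basis(2)) (simp_all only: fourier_gaussian_real assms)
  also have "\<dots> = of_real (sqrt (pi / p) ^ DIM('a) * (\<Prod>b\<in>Basis. exp (- (\<xi> \<bullet> b)\<^sup>2 / (4 * p))))"
    by (simp add: prod.distrib)
  also have "(\<Prod>b\<in>Basis. exp (- (\<xi> \<bullet> b)\<^sup>2 / (4 * p))) = exp (- (norm \<xi>)\<^sup>2 / (4 * p))"
    by (simp add: exp_sum[symmetric] sq sum_divide_distrib sum_negf)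
  also have "sqrt (pi / p) ^ DIM('a) = (pi / p) powr (real DIM('a) / 2)"
    using assms by (simp add: powr_half_sqrt[symmetric] powr_realpow[symmetric] powr_powr)
  finally show "fourier (\<lambda>x::'a. exp (- p * (norm x)\<^sup>2)) \<xi>
      = of_real ((pi / p) powr (real DIM('a) / 2) * exp (- (norm \<xi>)\<^sup>2 / (4 * p)))" .
qed

lemma integral_lborel_scaleR:
  fixes f :: "'a::euclidean_space \<Rightarrow> 'b::{banach,second_countable_topology}"
  assumes [measurable]: "f \<in> borel_measurable borel" and "c \<noteq> 0"
  shows "(\<integral>x. f x \<partial>lborel) = \<bar>c\<bar> ^ DIM('a) *\<^sub>R (\<integral>x. f (c *\<^sub>R x) \<partial>lborel)"
  by (subst lborel_affine[OF assms(2), of 0]) (simp add: integral_density integral_distr)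

section \<open>Truncated powers of the squared radius and their Fourier transforms\<close>

text \<open>The exponent \<open>r = 0\<close> is included and gives the indicator of the open ball.
  It enters as the case \<open>q = 0\<close>, from which the fractional Laplacian of
  \<open>trunc_power s l\<close> is obtained.\<close>

definition trunc_power :: "real \<Rightarrow> real \<Rightarrow> 'a::euclidean_space \<Rightarrow> real" where
  "trunc_power r l x = (if (norm x)\<^sup>2 < l then (l - (norm x)\<^sup>2) powr r else 0)"

text \<open>Kept as an unevaluated constant: the estimates compare masses for different
  \<open>l > 0\<close>, which are multiples of this one by powers of \<open>l\<close>.\<close>

definition mass :: "'a::euclidean_space itself \<Rightarrow> real \<Rightarrow> real" where
  "mass _ r = (\<integral>x. trunc_power r 1 x \<partial>(lborel :: 'a measure))"

lemma trunc_power_nonneg: "trunc_power r l x \<ge> 0"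
  by (simp add: trunc_power_def)

lemma trunc_power_mono:
  "0 \<le> r \<Longrightarrow> l \<le> m \<Longrightarrow> trunc_power r l x \<le> trunc_power r m x"
  by (auto simp: trunc_power_def intro!: powr_mono2)

lemma trunc_power_measurable [measurable]:
  assumes [measurable]: "f \<in> borel_measurable M" "g \<in> borel_measurable M"
  shows "(\<lambda>x. trunc_power r (f x) (g x)) \<in> borel_measurable M"
  unfolding trunc_power_def by measurable

lemma trunc_power_nonpos: "l \<le> 0 \<Longrightarrow> trunc_power r l x = 0"
  by (smt (verit) trunc_power_def zero_le_power2)

lemma integrable_trunc_power:
  assumes "r \<ge> 0"
  shows "integrable lborel (trunc_power r l :: 'a::euclidean_space \<Rightarrow> real)"
proof (rule Bochner_Integration.integrable_bound)
  show "integrable lborel (\<lambda>x::'a. \<bar>l\<bar> powr r * indicator (cball 0 (sqrt \<bar>l\<bar>)) x :: real)"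
    by (intro integrable_mult_right integrable_real_indicator) (use emeasure_bounded_finite[OF bounded_cball] in auto)
  show "AE x in lborel. norm (trunc_power r l x) \<le> norm (\<bar>l\<bar> powr r * indicator (cball 0 (sqrt \<bar>l\<bar>)) (x::'a) :: real)"
  proof (rule AE_I2)
    fix x :: 'a
    show "norm (trunc_power r l x) \<le> norm (\<bar>l\<bar> powr r * indicator (cball 0 (sqrt \<bar>l\<bar>)) x :: real)"
    proof (cases "(norm x)\<^sup>2 < l")
      case True
      then have "l > 0" by (smt (verit) zero_le_power2)
      then have "norm x \<le> sqrt l"
        using True by (simp add: real_le_rsqrt)
      with True \<open>l > 0\<close> show ?thesis
        by (auto simp: trunc_power_def assms intro!: powr_mono2)
    qed (simp add: trunc_power_def)
  qed
qed simp

lemma trunc_power_scale: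
  assumes "c > 0"
  shows "trunc_power r (c * l) (sqrt c *\<^sub>R x) = c powr r * trunc_power r l x"
  using assms
  by (simp add: trunc_power_def power_mult_distrib right_diff_distrib[symmetric] powr_mult)

text \<open>The dilation by \<open>sqrt l\<close> contributes \<open>l powr (d / 2)\<close> from the
  volume and \<open>l powr r\<close> from homogeneity.\<close>

lemma integral_trunc_power:
  assumes "l > 0"
  shows "(\<integral>x. trunc_power r l x \<partial>(lborel :: 'a::euclidean_space measure)) = l powr (real DIM('a) / 2 + r) * mass TYPE('a) r"
proof -
  have "(\<integral>x. trunc_power r l x \<partial>(lborel :: 'a measure)) = \<bar>sqrt l\<bar> ^ DIM('a) *\<^sub>R (\<integral>x. trunc_power r (l * 1) (sqrt l *\<^sub>R x) \<partial>(lborel :: 'a measure))"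
    using assms by (subst integral_lborel_scaleR[where c = "sqrt l"]) auto
  also have "\<dots> = sqrt l ^ DIM('a) * (l powr r * mass TYPE('a) r)"
    using assms unfolding mass_def by (subst trunc_power_scale) auto
  also have "sqrt l ^ DIM('a) = l powr (real DIM('a) / 2)"
    using assms by (simp add: powr_half_sqrt[symmetric] powr_realpow[symmetric] powr_powr)
  finally show ?thesis by (simp add: powr_add)
qed

lemma mass_nonneg: "mass T r \<ge> 0"
  unfolding mass_def by (intro integral_nonneg_AE AE_I2 trunc_power_nonneg)

lemma integrable_fourier:
  assumes "integrable lborel f"
  shows "integrable lborel (\<lambda>x. complex_of_real (f x) * cis (- (\<xi> \<bullet> x)))"
proof (rule Bochner_Integration.integrable_bound[OF assms])
  have [measurable]: "f \<in> borel_measurable borel" using assms by auto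
  have [measurable]: "(\<lambda>x. cis (- (\<xi> \<bullet> x))) \<in> borel_measurable borel"
    by (intro borel_measurable_continuous_onI continuous_intros)
  show "(\<lambda>x. complex_of_real (f x) * cis (- (\<xi> \<bullet> x))) \<in> borel_measurable lborel"
    by simp
qed (simp add: norm_mult)

lemma norm_fourier_le:
  assumes "integrable lborel f"
  shows "norm (fourier f \<xi>) \<le> (\<integral>x. \<bar>f x\<bar> \<partial>lborel)"
  unfolding fourier_def
  using integral_norm_bound[of lborel "\<lambda>x. complex_of_real (f x) * cis (- (\<xi> \<bullet> x))"]
  by (simp add: norm_mult)

lemma fourier_diff:
  assumes "integrable lborel f" "integrable lborel g"
  shows "fourier (\<lambda>x. f x - g x) \<xi> = fourier f \<xi> - fourier g \<xi>"
  unfolding fourier_def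
  by (subst Bochner_Integration.integral_diff[symmetric])
     (auto intro!: integrable_fourier assms simp: left_diff_distrib)

lemma norm_fourier_trunc_power_le:
  fixes \<xi> :: "'a::euclidean_space"
  assumes "r \<ge> 0" "l > 0"
  shows "norm (fourier (trunc_power r l) \<xi>) \<le> l powr (real DIM('a) / 2 + r) * mass TYPE('a) r"
  using norm_fourier_le[OF integrable_trunc_power[OF assms(1)], of l \<xi>]
  by (simp add: abs_of_nonneg trunc_power_nonneg integral_trunc_power assms)

text \<open>Monotonicity of \<^term>\<open>trunc_power r l\<close> in \<^term>\<open>l\<close> turns the modulus of continuity
  of its Fourier transform into a difference of total masses.\<close>
lemma norm_diff_fourier_trunc_power_le:
  fixes \<xi> :: "'a::euclidean_space"
  assumes "r \<ge> 0" "l > 0" "m > 0"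
  shows "norm (fourier (trunc_power r l) \<xi> - fourier (trunc_power r m) \<xi>)
    \<le> \<bar>l powr (real DIM('a) / 2 + r) - m powr (real DIM('a) / 2 + r)\<bar> * mass TYPE('a) r"
  using assms(2,3)
proof (induction l m rule: linorder_wlog)
  case (le l m)
  let ?f = "\<lambda>x::'a. trunc_power r m x - trunc_power r l x"
  have int: "integrable lborel ?f"
    by (intro Bochner_Integration.integrable_diff integrable_trunc_power assms)
  have "norm (fourier (trunc_power r l) \<xi> - fourier (trunc_power r m) \<xi>) = norm (fourier ?f \<xi>)"
    by (subst fourier_diff) (auto simp: norm_minus_commute intro!: integrable_trunc_power assms)
  also have "\<dots> \<le> (\<integral>x. ?f x \<partial>lborel)"
    using norm_fourier_le[OF int, of \<xi>] le assms by (simp add: trunc_power_mono)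
  also have "\<dots> = (m powr (real DIM('a) / 2 + r) - l powr (real DIM('a) / 2 + r)) * mass TYPE('a) r"
    using le assms by (subst Bochner_Integration.integral_diff)
      (auto simp: integral_trunc_power left_diff_distrib intro!: integrable_trunc_power)
  finally show ?case
    using le assms mass_nonneg[of "TYPE('a)" r]
    by (smt (verit) mult_right_mono abs_ge_self)
next
  case (sym l m)
  then show ?case by (simp add: norm_minus_commute abs_minus_commute)
qed

text \<open>For \<open>r = 0\<close> the function jumps in \<open>l\<close> at a fixed point, so
  continuity is not read off pointwise. It comes from the bound by a difference of masses, which is
  continuous in \<open>l\<close>.\<close>

lemma continuous_on_fourier_trunc_power:
  fixes \<xi> :: "'a::euclidean_space"
  assumes "r \<ge> 0"
  shows "continuous_on {0<..} (\<lambda>l. fourier (trunc_power r l) \<xi>)"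
  unfolding continuous_on_def
proof safe
  fix m :: real assume m: "m > 0"
  let ?g = "\<lambda>l. \<bar>l powr (real DIM('a) / 2 + r) - m powr (real DIM('a) / 2 + r)\<bar> * mass TYPE('a) r"
  have "((\<lambda>l. fourier (trunc_power r l) \<xi> - fourier (trunc_power r m) \<xi>) \<longlongrightarrow> 0) (at m within {0<..})"
  proof (rule Lim_null_comparison[where g = ?g])
    show "\<forall>\<^sub>F l in at m within {0<..}. norm (fourier (trunc_power r l) \<xi> - fourier (trunc_power r m) \<xi>) \<le> ?g l"
      unfolding eventually_at_topological using assms m
      by (auto intro!: exI[of _ UNIV] norm_diff_fourier_trunc_power_le)
    have "(?g \<longlongrightarrow> ?g m) (at m within {0<..})"
      using m by (intro tendsto_intros) auto
    then show "(?g \<longlongrightarrow> 0) (at m within {0<..})" by simp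
  qed
  then show "((\<lambda>l. fourier (trunc_power r l) \<xi>) \<longlongrightarrow> fourier (trunc_power r m) \<xi>) (at m within {0<..})"
    using Lim_null by blast
qed

section \<open>Laplace transforms in the squared radius\<close>

text \<open>After the shift of \<open>l\<close> by \<open>(norm x)\<^sup>2\<close> the truncation
  restricts to the positive half-line, so a Gamma integral remains, and the shift itself pulls out a
  Gaussian in \<open>x\<close>. This is why the squared radius, and not the radius, is the Laplace
  variable.\<close>

lemma nn_integral_laplace_trunc_power:
  fixes x :: "'a::euclidean_space"
  assumes "r \<ge> 0" "p > 0"
  shows "(\<integral>\<^sup>+l. ennreal (exp (- p * l) * trunc_power r l x) \<partial>lborel)
    = ennreal (Gamma (r + 1) * p powr - (r + 1) * exp (- p * (norm x)\<^sup>2))"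
proof -
  have "(\<integral>\<^sup>+l. ennreal (exp (- p * l) * trunc_power r l x) \<partial>lborel)
     = (\<integral>\<^sup>+l. ennreal (exp (- p * ((norm x)\<^sup>2 + 1 * l)) * trunc_power r ((norm x)\<^sup>2 + 1 * l) x) \<partial>lborel)"
    by (subst nn_integral_real_affine[where c = 1 and t = "(norm x)\<^sup>2"]) auto
  also have "\<dots> = (\<integral>\<^sup>+l. ennreal (exp (- p * (norm x)\<^sup>2)) * ennreal (indicator {0<..} l * (l powr ((r + 1) - 1) * exp (- p * l))) \<partial>lborel)"
  proof (intro nn_integral_cong, goal_cases)
    case (1 l)
    have "exp (- p * ((norm x)\<^sup>2 + l)) = exp (- p * (norm x)\<^sup>2) * exp (- p * l)"
      by (simp add: exp_add[symmetric] algebra_simps)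
    then show ?case
      by (auto simp: trunc_power_def ennreal_mult[symmetric] indicator_def)
  qed
  also have "\<dots> = ennreal (exp (- p * (norm x)\<^sup>2)) * ennreal (Gamma (r + 1) * p powr - (r + 1))"
    by (subst nn_integral_cmult) (use nn_integral_powr_exp[of "r + 1" p] assms in auto)
  finally show ?thesis
    using assms by (simp add: ennreal_mult[symmetric] mult_ac Gamma_real_nonneg)
qed

lemma laplace_trunc_power:
  fixes x :: "'a::euclidean_space"
  assumes "r \<ge> 0" "p > 0"
  shows "has_bochner_integral lborel (\<lambda>l. exp (- p * l) * trunc_power r l x)
    (Gamma (r + 1) * p powr - (r + 1) * exp (- p * (norm x)\<^sup>2))"
  using assms nn_integral_laplace_trunc_power[OF assms, of x]
  by (intro has_bochner_integral_nn_integral)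
     (auto simp: trunc_power_nonneg Gamma_real_nonneg)

text \<open>Fubini exchanges the Laplace and the Fourier integral. The character has modulus 1 and
  \<open>trunc_power\<close> is nonnegative, so the absolute integral in \<open>l\<close> is again a
  Gaussian in \<open>x\<close>, which is integrable.\<close>

lemma laplace_fourier_trunc_power:
  fixes \<xi> :: "'a::euclidean_space"
  assumes "r \<ge> 0" "p > 0"
  shows "has_bochner_integral lborel (\<lambda>l. exp (- p * l) *\<^sub>R fourier (trunc_power r l) \<xi>)
    (of_real (Gamma (r + 1) * p powr - (r + 1) * ((pi / p) powr (real DIM('a) / 2)
       * exp (- (norm \<xi>)\<^sup>2 / (4 * p)))))"
proof -
  define e where "e = (\<lambda>x. cis (- (\<xi> \<bullet> x)))"
  have [measurable]: "e \<in> borel_measurable borel"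
    unfolding e_def by (intro borel_measurable_continuous_onI continuous_intros)
  have [simp]: "norm (e x) = 1" for x by (simp add: e_def)
  define F where "F = (\<lambda>(x::'a) (l::real). (exp (- p * l) * trunc_power r l x) *\<^sub>R e x)"
  have L: "integrable lborel (\<lambda>l. exp (- p * l) * trunc_power r l x)"
          "(\<integral>l. exp (- p * l) * trunc_power r l x \<partial>lborel) = Gamma (r + 1) * p powr - (r + 1) * exp (- p * (norm x)\<^sup>2)" for x :: 'a
    using laplace_trunc_power[OF assms, of x] by (auto simp: has_bochner_integral_iff)
  have gauss: "integrable lborel (\<lambda>x::'a. exp (- p * (norm x)\<^sup>2))"
    using integrable_norm[OF fourier_gaussian(1)[OF assms(2), where \<xi> = "0::'a"]]
    by (simp add: norm_mult)
  have int: "integrable (lborel \<Otimes>\<^sub>M lborel) (case_prod F)"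
  proof (rule lborel_pair.Fubini_integrable)
    show "case_prod F \<in> borel_measurable (lborel \<Otimes>\<^sub>M lborel)"
      unfolding F_def by measurable
    show "integrable lborel (\<lambda>x. \<integral>l. norm (case_prod F (x, l)) \<partial>lborel)"
      unfolding F_def by (simp add: abs_mult abs_of_nonneg trunc_power_nonneg L(2)[simplified]) (use gauss in simp)
    show "AE x in lborel. integrable lborel (\<lambda>l. case_prod F (x, l))"
      unfolding F_def by (intro AE_I2) (simp, rule integrable_scaleR_left, rule L(1)[simplified])
  qed
  have inner: "(\<integral>x. F x l \<partial>lborel) = exp (- p * l) *\<^sub>R fourier (trunc_power r l) \<xi>" for l
    unfolding F_def fourier_def e_def by (simp add: scaleR_conv_of_real mult.assoc)
  have outer: "(\<integral>l. F x l \<partial>lborel) = (Gamma (r + 1) * p powr - (r + 1) * exp (- p * (norm x)\<^sup>2)) *\<^sub>R e x" for x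
    unfolding F_def using L by (subst integral_scaleR_left) auto
  have "integrable lborel (\<lambda>l. \<integral>x. F x l \<partial>lborel)"
    using lborel_pair.integrable_snd[of F] int by simp
  moreover have "(\<integral>l. (\<integral>x. F x l \<partial>lborel) \<partial>lborel) = (\<integral>x. (\<integral>l. F x l \<partial>lborel) \<partial>lborel)"
    by (rule lborel_pair.Fubini_integral[OF int])
  moreover have "\<dots> = complex_of_real (Gamma (r + 1) * p powr - (r + 1)) * fourier (\<lambda>x. exp (- p * (norm x)\<^sup>2)) \<xi>"
    unfolding outer fourier_def e_def by (simp add: scaleR_conv_of_real mult.assoc)
  ultimately show ?thesis
    using assms fourier_gaussian(2)[OF assms(2), of \<xi>] by (simp add: has_bochner_integral_iff inner)
qed

text \<open>The powers of \<open>exp (- l)\<close> are the monomials in \<open>u = exp (- l)\<close>, so the Weierstrass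
  approximation theorem on \<open>[0, 1]\<close> applies.\<close>
lemma laplace_eq_0_imp_eq_0_real:
  fixes f :: "real \<Rightarrow> real"
  assumes cont: "continuous_on {0<..} f"
    and at_0: "(f \<longlongrightarrow> 0) (at_right 0)"
    and at_inf: "((\<lambda>l. exp (- l) * f l) \<longlongrightarrow> 0) at_top"
    and int: "\<And>p. p > 0 \<Longrightarrow> has_bochner_integral lborel (\<lambda>l. indicator {0<..} l * (exp (- p * l) * f l)) 0"
    and "l > 0"
  shows "f l = 0"
proof -
  \<comment> \<open>One factor \<open>exp (- l)\<close> is absorbed, so that \<open>g\<close>
    vanishes at infinity even where \<open>f\<close> grows. In the variable
    \<open>u = exp (- l)\<close> the value 0 of \<open>h\<close> at both ends is then its limit:
    \<open>u = 0\<close> corresponds to large \<open>l\<close> and \<open>u = 1\<close> to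
    \<open>l\<close> tending to 0.\<close>
  define g where "g = (\<lambda>l. exp (- l) * f l)"
  define h where "h = (\<lambda>u. if 0 < u \<and> u < 1 then g (- ln u) else 0)"
  define w where "w = (\<lambda>l::real. indicator {0<..} l * exp (- l))"
  have g_0: "(g \<longlongrightarrow> 0) (at_right 0)"
    unfolding g_def by (auto intro!: tendsto_eq_intros at_0)
  have cont_g: "continuous_on {0<..} g"
    unfolding g_def by (intro continuous_intros cont)
  have contI: "continuous_on {0<..<1} (\<lambda>u. g (- ln u))"
    by (rule continuous_on_compose2[OF cont_g]) (auto intro!: continuous_intros)
  have cont_h: "continuous_on {0..1} h"
    unfolding continuous_on_def
  proof safe
    fix u :: real assume u: "u \<in> {0..1}"
    consider "u = 0" | "u = 1" | "0 < u" "u < 1" using u by fastforce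
    then show "(h \<longlongrightarrow> h u) (at u within {0..1})"
    proof cases
      case 1
      have "((\<lambda>u. g (- ln u)) \<longlongrightarrow> 0) (at_right 0)"
        by (rule filterlim_compose[OF at_inf[folded g_def]]) (auto simp: filterlim_uminus_at_bot[symmetric] ln_at_0 filterlim_uminus_at_top)
      moreover have "\<forall>\<^sub>F u in at_right 0. u < (1::real)"
        by (auto simp: eventually_at_right_field intro!: exI[of _ 1])
      then have "\<forall>\<^sub>F u in at_right 0. g (- ln u) = h u"
        using eventually_at_right_less[of 0] by eventually_elim (auto simp: h_def)
      ultimately have "(h \<longlongrightarrow> 0) (at_right 0)"
        by (rule Lim_transform_eventually)
      with 1 show ?thesis
        by (simp add: h_def at_within_Icc_at_right)
    next
      case 2
      have "filterlim (\<lambda>u::real. - ln u) (at_right 0) (at_left 1)"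
        by real_asymp
      then have "((\<lambda>u. g (- ln u)) \<longlongrightarrow> 0) (at_left 1)"
        by (rule filterlim_compose[OF g_0])
      moreover have "\<forall>\<^sub>F u in at_left 1. g (- ln u) = h u"
        unfolding eventually_at_left_field by (auto simp: h_def intro!: exI[of _ 0])
      ultimately have "(h \<longlongrightarrow> 0) (at_left 1)"
        by (rule Lim_transform_eventually)
      with 2 show ?thesis
        by (simp add: h_def at_within_Icc_at_left)
    next
      case 3
      have "((\<lambda>u. g (- ln u)) \<longlongrightarrow> g (- ln u)) (at u)"
        using contI 3 by (simp add: continuous_on_eq_continuous_at isCont_def)
      moreover have "\<forall>\<^sub>F v in at u. g (- ln v) = h v"
        unfolding eventually_at_topological using 3
        by (auto simp: h_def intro!: exI[of _ "{0<..<1}"])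
      ultimately have "(h \<longlongrightarrow> g (- ln u)) (at u)"
        by (rule Lim_transform_eventually)
      with 3 show ?thesis
        by (auto simp: h_def intro: tendsto_within_subset)
    qed
  qed
  have hg: "h (exp (- l)) = g l" if "l > 0" for l
    using that by (simp add: h_def)
  \<comment> \<open>The Laplace exponent is \<open>n + 2\<close>: one factor
    \<open>exp (- l)\<close> from the weight \<open>w\<close>, one from \<open>g\<close>, and
    \<open>n\<close> from the monomial.\<close>
  have moments: "has_bochner_integral lborel (\<lambda>l. w l * g l * exp (- l) ^ n) 0" for n
    using int[of "real n + 2"] 
    by (rule has_bochner_integral_cong[THEN iffD1, rotated -1])
      (auto simp: w_def g_def exp_of_nat_mult[symmetric] exp_add[symmetric] algebra_simps indicator_def)
  have int_wg: "integrable lborel (\<lambda>l. w l * g l)"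
    using moments[of 0] by (simp add: has_bochner_integral_iff)
  obtain B where B: "\<forall>u\<in>{0..1}. \<bar>h u\<bar> \<le> B"
    using compact_imp_bounded[OF compact_continuous_image[OF cont_h compact_Icc]]
    by (auto simp: bounded_iff)
  have [measurable]: "(\<lambda>l. w l * g l) \<in> borel_measurable borel"
    using int_wg by auto
  \<comment> \<open>Testing against \<open>g\<close> itself, cut off at 0 to be measurable on the
    whole line, makes the integrand \<open>w * g * sg\<close> nonnegative.\<close>
  define sg where "sg = (\<lambda>l. indicator {0<..} l * g l)"
  have [measurable]: "sg \<in> borel_measurable borel"
    unfolding sg_def using borel_measurable_continuous_on_indicator[OF _ cont_g] by (simp add: mult.commute)
  have int_wgg: "integrable lborel (\<lambda>l. w l * g l * sg l)"
  proof (rule Bochner_Integration.integrable_bound[OF integrable_mult_right[OF int_wg, of B]])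
    show "AE l in lborel. norm (w l * g l * sg l) \<le> norm (B * (w l * g l))"
    proof (rule AE_I2)
      fix l :: real
      have "\<bar>sg l\<bar> \<le> \<bar>B\<bar>"
        using B[rule_format, of "exp (- l)"] hg[of l] by (cases "l > 0") (auto simp: sg_def)
      then show "norm (w l * g l * sg l) \<le> norm (B * (w l * g l))"
        by (simp add: abs_mult mult.commute mult_right_mono)
    qed
  qed simp
  define I where "I = (\<integral>l. w l * g l * sg l \<partial>lborel)"
  define J where "J = (\<integral>l. \<bar>w l * g l\<bar> \<partial>lborel)"
  \<comment> \<open>A polynomial \<open>q\<close> in \<open>exp (- l)\<close> approximates
    \<open>sg\<close> within \<open>e\<close> on the positive half-line. Its integral against
    \<open>w * g\<close> is a sum of vanishing moments, so only the approximation error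
    remains.\<close>
  have bound: "\<bar>I\<bar> \<le> e * J" if e: "e > 0" for e
  proof -
    obtain q where q: "real_polynomial_function q" "\<And>u. u \<in> {0..1} \<Longrightarrow> \<bar>h u - q u\<bar> < e"
      using Stone_Weierstrass_real_polynomial_function[OF compact_Icc cont_h e] by blast
    then obtain a n where qa: "q = (\<lambda>x. \<Sum>i\<le>n. a i * x ^ i)"
      by (auto simp: real_polynomial_function_iff_sum)
    have q0: "has_bochner_integral lborel (\<lambda>l. w l * g l * q (exp (- l))) (\<Sum>i\<le>n. a i * 0)"
      unfolding qa sum_distrib_left mult.left_commute[of _ "a _"]
      by (intro has_bochner_integral_sum has_bochner_integral_mult_right moments)
    then have "I = (\<integral>l. w l * g l * sg l - w l * g l * q (exp (- l)) \<partial>lborel)"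
      by (subst Bochner_Integration.integral_diff) (auto simp: int_wgg has_bochner_integral_iff I_def)
    also have "norm \<dots> \<le> (\<integral>l. e * \<bar>w l * g l\<bar> \<partial>lborel)"
    proof (rule Bochner_Integration.integral_norm_bound_integral)
      show "integrable lborel (\<lambda>l. w l * g l * sg l - w l * g l * q (exp (- l)))"
        using q0 int_wgg by (auto simp: has_bochner_integral_iff)
      show "integrable lborel (\<lambda>l. e * \<bar>w l * g l\<bar>)"
        by (intro integrable_mult_right integrable_abs int_wg)
      fix l :: real
      have "\<bar>w l * g l\<bar> * \<bar>sg l - q (exp (- l))\<bar> \<le> \<bar>w l * g l\<bar> * e"
      proof (cases "l > 0")
        case True
        then show ?thesis
          using q(2)[of "exp (- l)"] hg[of l] by (intro mult_left_mono) (auto simp: sg_def)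
      qed (simp add: w_def)
      then show "norm (w l * g l * sg l - w l * g l * q (exp (- l))) \<le> e * \<bar>w l * g l\<bar>"
        by (simp only: right_diff_distrib[symmetric] real_norm_def abs_mult mult.commute[of e])
    qed
    finally show ?thesis by (simp add: J_def)
  qed
  have "I = 0"
  proof (rule ccontr)
    assume I: "I \<noteq> 0"
    have J: "J \<ge> 0" unfolding J_def by simp
    \<comment> \<open>The summand 1 in \<open>J + 1\<close> also covers the case
      \<open>J = 0\<close>.\<close>
    have "\<bar>I\<bar> \<le> (\<bar>I\<bar> / (2 * (J + 1))) * J"
      using I J by (intro bound divide_pos_pos) auto
    also have "\<dots> < \<bar>I\<bar>"
      using I J by (simp add: field_simps add_nonneg_pos)
    finally show False by simp
  qed
  moreover have nn: "w l * g l * sg l \<ge> 0" for l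
    by (cases "l > 0") (auto simp: w_def sg_def mult.assoc)
  ultimately have ae: "AE l in lborel. w l * g l * sg l = 0"
    using integral_nonneg_eq_0_iff_AE[OF int_wgg] by (auto simp: I_def)
  \<comment> \<open>Continuity upgrades vanishing almost everywhere: the set where \<open>g\<close>
    is nonzero is open and null, hence empty.\<close>
  have "g l = 0"
  proof (rule ccontr)
    assume "g l \<noteq> 0"
    then have "l \<in> {0<..} \<inter> g -` (- {0})" using \<open>l > 0\<close> by auto
    moreover have op: "open ({0<..} \<inter> g -` (- {0}))"
      by (rule continuous_open_preimage[OF cont_g]) auto
    moreover have "AE l in lborel. l \<notin> {0<..} \<inter> g -` (- {0})"
      using ae by eventually_elim (auto simp: w_def sg_def)
    then have "{0<..} \<inter> g -` (- {0}) \<in> null_sets lborel"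
      using op by (subst AE_iff_null_sets) auto
    then have "negligible ({0<..} \<inter> g -` (- {0}))"
      by (simp add: negligible_iff_null_sets null_sets_completionI)
    ultimately show False
      using open_not_negligible by blast
  qed
  then show ?thesis by (simp add: g_def)
qed

lemma laplace_eq_0_imp_eq_0:
  fixes f :: "real \<Rightarrow> complex"
  assumes cont: "continuous_on {0<..} f"
    and at_0: "(f \<longlongrightarrow> 0) (at_right 0)"
    and at_inf: "((\<lambda>l. exp (- l) *\<^sub>R f l) \<longlongrightarrow> 0) at_top"
    and int: "\<And>p. p > 0 \<Longrightarrow> has_bochner_integral lborel (\<lambda>l. indicator {0<..} l *\<^sub>R (exp (- p * l) *\<^sub>R f l)) 0"
    and "l > 0"
  shows "f l = 0"
proof -
  have "Re (f l) = 0"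
  proof (rule laplace_eq_0_imp_eq_0_real[where f = "\<lambda>l. Re (f l)"])
    show "has_bochner_integral lborel (\<lambda>l. indicator {0<..} l * (exp (- p * l) * Re (f l))) 0" if "p > 0" for p
      using has_bochner_integral_bounded_linear[OF bounded_linear_Re int[OF that]] by (simp add: mult.assoc)
    show "((\<lambda>l. exp (- l) * Re (f l)) \<longlongrightarrow> 0) at_top"
      using tendsto_Re[OF at_inf] by simp
  qed (use tendsto_Re[OF at_0] \<open>l > 0\<close> in \<open>auto intro!: continuous_intros cont\<close>)
  moreover have "Im (f l) = 0"
  proof (rule laplace_eq_0_imp_eq_0_real[where f = "\<lambda>l. Im (f l)"])
    show "has_bochner_integral lborel (\<lambda>l. indicator {0<..} l * (exp (- p * l) * Im (f l))) 0" if "p > 0" for p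
      using has_bochner_integral_bounded_linear[OF bounded_linear_Im int[OF that]] by (simp add: mult.assoc)
    show "((\<lambda>l. exp (- l) * Im (f l)) \<longlongrightarrow> 0) at_top"
      using tendsto_Im[OF at_inf] by simp
  qed (use tendsto_Im[OF at_0] \<open>l > 0\<close> in \<open>auto intro!: continuous_intros cont\<close>)
  ultimately show ?thesis by (simp add: complex_eq_iff)
qed

section \<open>The fractional Laplacian of truncated powers\<close>

text \<open>For \<open>l > 0\<close> and \<open>t > 0\<close> the weight gives both terms the same
  total mass, so the difference has integral 0, in accordance with a multiplier that vanishes at
  frequency 0.\<close>

definition trunc_power_diff :: "real \<Rightarrow> real \<Rightarrow> real \<Rightarrow> 'a::euclidean_space \<Rightarrow> real" where
  "trunc_power_diff q l t x =
     trunc_power q l x - (1 + t) powr - (real DIM('a) / 2 + q) * trunc_power q (l * (1 + t)) x"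

text \<open>Each factor undoes one constant: \<open>s / Gamma (1 - s)\<close> that of the Marchaud
  integral of an exponential, \<open>4 powr s\<close> the 4 in
  \<open>(norm \<xi>)\<^sup>2 / (4 * p)\<close>, while the quotient of Gamma values replaces the
  Laplace constant for exponent \<open>q\<close> by the one for \<open>q + s\<close>.\<close>

definition frac_coeff :: "real \<Rightarrow> real \<Rightarrow> real" where
  "frac_coeff s q = 4 powr s * s * Gamma (q + s + 1) / (Gamma (q + 1) * Gamma (1 - s))"

text \<open>For \<open>q = 0\<close> the integral diverges on the sphere \<open>|x|^2 = l\<close>, where its value is the junk
  value 0; this null set is irrelevant for the Fourier transform.\<close>
definition frac_trunc_power :: "real \<Rightarrow> real \<Rightarrow> real \<Rightarrow> 'a::euclidean_space \<Rightarrow> real" where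
  "frac_trunc_power s q l x = frac_coeff s q *
     (\<integral>t. indicator {0<..} t * t powr (- 1 - s) * trunc_power_diff q l t x \<partial>lborel)"

lemma trunc_power_diff_measurable [measurable]:
  assumes [measurable]: "f \<in> borel_measurable M" "g \<in> borel_measurable M" "h \<in> borel_measurable M"
  shows "(\<lambda>x. trunc_power_diff q (f x) (g x) (h x)) \<in> borel_measurable M"
  unfolding trunc_power_diff_def by measurable

lemma integrable_trunc_power_diff:
  "q \<ge> 0 \<Longrightarrow> integrable lborel (trunc_power_diff q l t)"
  unfolding trunc_power_diff_def
  by (intro Bochner_Integration.integrable_diff integrable_mult_right integrable_trunc_power)

lemma fourier_trunc_power_diff:
  fixes \<xi> :: "'a::euclidean_space"
  assumes "q \<ge> 0"
  shows "fourier (trunc_power_diff q l t) \<xi> = fourier (trunc_power q l) \<xi>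
    - (1 + t) powr - (real DIM('a) / 2 + q) *\<^sub>R fourier (trunc_power q (l * (1 + t))) \<xi>"
proof -
  have "fourier (\<lambda>x. c * trunc_power q m x) \<xi> = c *\<^sub>R fourier (trunc_power q m) \<xi>" for c m
    by (simp add: fourier_def scaleR_conv_of_real mult.assoc)
  then show ?thesis
    unfolding trunc_power_diff_def
    by (subst fourier_diff) (auto intro!: integrable_trunc_power assms)
qed

text \<open>Split \<open>f - w g = (1 - w) f - w (g - f)\<close> with \<open>f \<le> g\<close>; by scaling \<open>w\<close> times the mass of
  \<open>g\<close> is the mass of \<open>f\<close>.\<close>
lemma integral_abs_trunc_power_diff:
  assumes "q \<ge> 0" "l > 0" "t \<ge> 0"
  shows "(\<integral>x. \<bar>trunc_power_diff q l t x\<bar> \<partial>(lborel :: 'a::euclidean_space measure))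
    \<le> (1 - (1 + t) powr - (real DIM('a) / 2 + q))
        * (2 * l powr (real DIM('a) / 2 + q) * mass TYPE('a) q)"
proof -
  define e where "e = real DIM('a) / 2 + q"
  define w where "w = (1 + t) powr - e"
  have e: "e > 0" using assms by (simp add: e_def add_pos_nonneg)
  have w: "0 < w" "w \<le> 1"
    using assms e by (auto simp: w_def powr_minus field_simps ge_one_powr_ge_zero)
  have w_scale: "w * (l * (1 + t)) powr e = l powr e"
    using assms by (simp add: w_def powr_mult powr_minus divide_simps)
  let ?f = "trunc_power q l :: 'a \<Rightarrow> real" and ?g = "trunc_power q (l * (1 + t)) :: 'a \<Rightarrow> real"
  have int: "integrable lborel ?f" "integrable lborel ?g"
    using assms by (auto intro: integrable_trunc_power)
  have "(\<integral>x. \<bar>trunc_power_diff q l t x\<bar> \<partial>(lborel :: 'a measure))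
      \<le> (\<integral>x. (1 - w) * ?f x + w * (?g x - ?f x) \<partial>lborel)"
  proof (rule integral_mono)
    show "integrable lborel (\<lambda>x::'a. \<bar>trunc_power_diff q l t x\<bar>)"
      using assms by (intro integrable_abs integrable_trunc_power_diff)
    show "integrable lborel (\<lambda>x. (1 - w) * ?f x + w * (?g x - ?f x))"
      by (intro Bochner_Integration.integrable_add Bochner_Integration.integrable_diff integrable_mult_right int)
    fix x :: 'a
    have "?f x \<le> ?g x"
      using assms by (intro trunc_power_mono) (auto simp: algebra_simps)
    then have "0 \<le> (1 - w) * ?f x" "0 \<le> w * (?g x - ?f x)"
      using w by (auto intro!: mult_nonneg_nonneg trunc_power_nonneg)
    moreover have "trunc_power_diff q l t x = (1 - w) * ?f x - w * (?g x - ?f x)"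
      by (simp add: trunc_power_diff_def w_def e_def algebra_simps)
    ultimately show "\<bar>trunc_power_diff q l t x\<bar> \<le> (1 - w) * ?f x + w * (?g x - ?f x)"
      by linarith
  qed
  moreover have "l + l * t > 0"
    using assms by (simp add: add_pos_nonneg)
  ultimately have "(\<integral>x. \<bar>trunc_power_diff q l t x\<bar> \<partial>(lborel :: 'a measure))
      \<le> (1 - w) * (l powr e * mass TYPE('a) q)
      + (w * (l * (1 + t)) powr e - w * l powr e) * mass TYPE('a) q"
    using int assms integral_trunc_power[of l q, where 'a='a] integral_trunc_power[of "l * (1 + t)" q, where 'a='a]
    by (simp add: e_def algebra_simps)
  also have "\<dots> = (1 - w) * (2 * l powr e * mass TYPE('a) q)"
    unfolding w_scale by (simp add: algebra_simps)
  finally show ?thesis by (simp add: w_def e_def)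
qed

lemma has_bochner_integral_powr_Marchaud:
  fixes s b :: real
  assumes "0 < s" "s < 1" "b > 0"
  shows "has_bochner_integral lborel (\<lambda>t. indicator {0<..} t * t powr (- 1 - s) * (1 - (1 + t) powr - b))
    (Gamma (b + s) * Gamma (1 - s) / (s * Gamma b))"
proof -
  have "(1 + t) powr - b \<le> 1" if "t > 0" for t :: real
    using that assms by (simp add: powr_minus field_simps ge_one_powr_ge_zero)
  then show ?thesis
    using nn_integral_powr_Marchaud[OF assms] assms
    by (intro has_bochner_integral_nn_integral)
       (auto simp: Gamma_real_nonneg indicator_def mult_ac)
qed

lemma norm_fourier_trunc_power_diff_le:
  fixes \<xi> :: "'a::euclidean_space"
  assumes "q \<ge> 0" "l > 0" "t \<ge> 0"
  shows "norm (fourier (trunc_power_diff q l t) \<xi>) \<le> (1 - (1 + t) powr - (real DIM('a) / 2 + q))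
        * (2 * l powr (real DIM('a) / 2 + q) * mass TYPE('a) q)"
  using norm_fourier_le[OF integrable_trunc_power_diff, of q l t \<xi>] integral_abs_trunc_power_diff[OF assms, where 'a='a] assms
  by simp

lemma fourier_trunc_power_measurable [measurable]:
  assumes [measurable]: "f \<in> borel_measurable M"
  shows "(\<lambda>y. fourier (trunc_power q (f y)) \<xi>) \<in> borel_measurable M"
proof -
  have [measurable]: "(\<lambda>x. cis (- (\<xi> \<bullet> x))) \<in> borel_measurable borel"
    by (intro borel_measurable_continuous_onI continuous_intros)
  have "(\<lambda>l. fourier (trunc_power q l) \<xi>) \<in> borel_measurable borel"
    unfolding fourier_def by measurable
  then show ?thesis by (rule measurable_compose[OF assms])
qed

lemma fourier_trunc_power_diff_measurable [measurable]:
  assumes [measurable]: "f \<in> borel_measurable M" "g \<in> borel_measurable M" and "q \<ge> 0"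
  shows "(\<lambda>y. fourier (trunc_power_diff q (f y) (g y)) \<xi>) \<in> borel_measurable M"
  unfolding fourier_trunc_power_diff[OF assms(3)] by measurable

text \<open>Fubini in \<open>t\<close> and \<open>x\<close>: by
  \<open>integral_abs_trunc_power_diff\<close> the \<open>L^1\<close> norms in \<open>x\<close> are
  at most a constant times \<open>1 - (1 + t) powr - e\<close>, and
  \<open>has_bochner_integral_powr_Marchaud\<close> integrates this against the kernel.\<close>

lemma fourier_frac_trunc_power:
  fixes \<xi> :: "'a::euclidean_space"
  assumes s: "0 < s" "s < 1" and q: "q \<ge> 0" and l: "l > 0"
  shows "integrable lborel (frac_trunc_power s q l :: 'a \<Rightarrow> real)"
    and "fourier (frac_trunc_power s q l) \<xi> = frac_coeff s q *\<^sub>R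
      (\<integral>t. (indicator {0<..} t * t powr (- 1 - s)) *\<^sub>R fourier (trunc_power_diff q l t) \<xi> \<partial>lborel)"
proof -
  define k where "k = (\<lambda>t::real. indicator {0<..} t * t powr (- 1 - s))"
  define e where "e = real DIM('a) / 2 + q"
  have e: "e > 0" using q by (simp add: e_def add_pos_nonneg)
  have k0: "k t \<ge> 0" for t by (simp add: k_def)
  have [measurable]: "k \<in> borel_measurable borel" unfolding k_def by measurable
  define E where "E = (\<lambda>x. cis (- (\<xi> \<bullet> x)))"
  have [measurable]: "E \<in> borel_measurable borel"
    unfolding E_def by (intro borel_measurable_continuous_onI continuous_intros)
  have [simp]: "norm (E x) = 1" for x by (simp add: E_def)
  let ?D = "\<lambda>t (x::'a). k t * trunc_power_diff q l t x"
  have int: "integrable (lborel \<Otimes>\<^sub>M lborel) (\<lambda>(t, x). ?D t x)"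
  proof (rule lborel_pair.Fubini_integrable)
    show "integrable lborel (\<lambda>t. \<integral>x. norm (case (t, x) of (t, x) \<Rightarrow> ?D t x) \<partial>lborel)"
    proof (rule Bochner_Integration.integrable_bound)
      show "integrable lborel (\<lambda>t. k t * (1 - (1 + t) powr - e) * (2 * l powr e * mass TYPE('a) q))"
        using has_bochner_integral_powr_Marchaud[OF s e]
        unfolding k_def has_bochner_integral_iff by (intro integrable_mult_left) auto
      show "AE t in lborel. norm (\<integral>x. norm (case (t, x) of (t, x) \<Rightarrow> ?D t x) \<partial>lborel)
          \<le> norm (k t * (1 - (1 + t) powr - e) * (2 * l powr e * mass TYPE('a) q))"
      proof (rule AE_I2)
        fix t :: real
        have "norm (\<integral>x. norm (case (t, x) of (t, x) \<Rightarrow> ?D t x) \<partial>lborel)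
          = k t * (\<integral>x. \<bar>trunc_power_diff q l t x\<bar> \<partial>(lborel :: 'a measure))"
          by (simp add: abs_mult k0)
        also have "\<dots> \<le> k t * ((1 - (1 + t) powr - e) * (2 * l powr e * mass TYPE('a) q))"
          using integral_abs_trunc_power_diff[OF q l, of t, where 'a='a]
          by (cases "t > 0") (auto simp: k_def e_def intro!: mult_left_mono)
        finally show "norm (\<integral>x. norm (case (t, x) of (t, x) \<Rightarrow> ?D t x) \<partial>lborel)
          \<le> norm (k t * (1 - (1 + t) powr - e) * (2 * l powr e * mass TYPE('a) q))"
          by simp
      qed
    qed simp
    show "AE t in lborel. integrable lborel (\<lambda>x. case (t, x) of (t, x) \<Rightarrow> ?D t x)"
      by (intro AE_I2) (simp add: integrable_trunc_power_diff q)
  qed simp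
  have "integrable lborel (\<lambda>x. \<integral>t. ?D t x \<partial>lborel)"
    using lborel_pair.integrable_snd[of ?D] int by simp
  then show "integrable lborel (frac_trunc_power s q l :: 'a \<Rightarrow> real)"
    unfolding frac_trunc_power_def k_def by simp
  let ?F = "\<lambda>t x. ?D t x *\<^sub>R E x"
  have intF: "integrable (lborel \<Otimes>\<^sub>M lborel) (\<lambda>(t, x). ?F t x)"
    by (rule Bochner_Integration.integrable_bound[OF int]) auto
  have "(\<integral>t. k t *\<^sub>R fourier (trunc_power_diff q l t) \<xi> \<partial>lborel) = (\<integral>t. (\<integral>x. ?F t x \<partial>lborel) \<partial>lborel)"
    unfolding fourier_def E_def by (simp add: scaleR_conv_of_real mult.assoc)
  also have "\<dots> = (\<integral>x. (\<integral>t. ?F t x \<partial>lborel) \<partial>lborel)"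
    by (rule lborel_pair.Fubini_integral[OF intF, symmetric])
  also have "\<dots> = (\<integral>x. (\<integral>t. ?D t x \<partial>lborel) *\<^sub>R E x \<partial>lborel)"
  proof (rule integral_cong_AE)
    \<comment> \<open>Only almost every \<open>x\<close> is available here, because for
      \<open>q = 0\<close> the integral in \<open>t\<close> diverges on the sphere.\<close>
    have "AE x in lborel. integrable lborel (\<lambda>t. ?D t x)"
      using lborel_pair.AE_integrable_snd[of ?D] int by simp
    then show "AE x in lborel. (\<integral>t. ?F t x \<partial>lborel) = (\<integral>t. ?D t x \<partial>lborel) *\<^sub>R E x"
      by eventually_elim (rule integral_scaleR_left, simp)
  qed simp_all
  finally show "fourier (frac_trunc_power s q l) \<xi> = frac_coeff s q *\<^sub>R
      (\<integral>t. (indicator {0<..} t * t powr (- 1 - s)) *\<^sub>R fourier (trunc_power_diff q l t) \<xi> \<partial>lborel)"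
    unfolding fourier_def frac_trunc_power_def E_def k_def
    by (simp add: scaleR_conv_of_real mult.assoc)
qed

section \<open>Passage of the Laplace transform through the Marchaud integral\<close>

text \<open>Dilating \<open>l\<close> by \<open>1 + t\<close> replaces \<open>p\<close> by
  \<open>p / (1 + t)\<close>, which turns the exponent \<open>- c\<close> into
  \<open>- c * (1 + t)\<close> for \<open>c = (norm \<xi>)\<^sup>2 / (4 * p)\<close>. The weight in
  \<open>trunc_power_diff\<close> is the power of \<open>1 + t\<close> for which no other dependence
  on \<open>t\<close> survives.\<close>

lemma laplace_fourier_trunc_power_diff:
  fixes \<xi> :: "'a::euclidean_space"
  assumes q: "q \<ge> 0" and p: "p > 0" and t: "t \<ge> 0"
  shows "has_bochner_integral lborel (\<lambda>l. exp (- p * l) *\<^sub>R fourier (trunc_power_diff q l t) \<xi>)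
    (of_real (Gamma (q + 1) * p powr - (q + 1) * (pi / p) powr (real DIM('a) / 2)
       * exp (- (norm \<xi>)\<^sup>2 / (4 * p)) * (1 - exp (- ((norm \<xi>)\<^sup>2 / (4 * p)) * t))))"
proof -
  define b where "b = real DIM('a) / 2"
  define z where "z = (norm \<xi>)\<^sup>2"
  define L where "L = (\<lambda>p. Gamma (q + 1) * p powr - (q + 1) * ((pi / p) powr b * exp (- z / (4 * p))))"
  define w where "w = (1 + t) powr - (b + q)"
  have L: "has_bochner_integral lborel (\<lambda>l. exp (- p * l) *\<^sub>R fourier (trunc_power q l) \<xi>) (of_real (L p))" if "p > 0" for p
    using laplace_fourier_trunc_power[OF q that, of \<xi>] by (simp add: L_def b_def z_def)
  define f where "f = (\<lambda>l. exp (- (p / (1 + t)) * l) *\<^sub>R fourier (trunc_power q l) \<xi>)"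
  have "has_bochner_integral lborel f (of_real (L (p / (1 + t))))"
    unfolding f_def using p t by (intro L) auto
  then have "has_bochner_integral lborel (\<lambda>l. f (0 + (1 + t) * l)) (of_real (L (p / (1 + t))) /\<^sub>R \<bar>1 + t\<bar>)"
    using t by (subst lborel_has_bochner_integral_real_affine_iff[symmetric]) auto
  moreover have "f (0 + (1 + t) * l) = exp (- p * l) *\<^sub>R fourier (trunc_power q (l * (1 + t))) \<xi>" for l
    using t by (simp add: f_def mult.commute)
  ultimately have "has_bochner_integral lborel
      (\<lambda>l. exp (- p * l) *\<^sub>R fourier (trunc_power q l) \<xi> - w *\<^sub>R (exp (- p * l) *\<^sub>R fourier (trunc_power q (l * (1 + t))) \<xi>))
      (of_real (L p) - w *\<^sub>R (of_real (L (p / (1 + t))) /\<^sub>R \<bar>1 + t\<bar>))"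
    using p by (intro has_bochner_integral_diff has_bochner_integral_scaleR_right L) simp_all
  moreover have "of_real (L p) - w *\<^sub>R (of_real (L (p / (1 + t))) /\<^sub>R \<bar>1 + t\<bar>)
     = complex_of_real (Gamma (q + 1) * p powr - (q + 1) * (pi / p) powr b * exp (- z / (4 * p)) * (1 - exp (- (z / (4 * p)) * t)))"
  proof -
    have "w * inverse (1 + t) * ((p / (1 + t)) powr - (q + 1) * (pi / (p / (1 + t))) powr b)
       = p powr - (q + 1) * (pi / p) powr b * ((1 + t) powr - (b + q) * (1 + t) powr -1 * (1 + t) powr (q + 1) * (1 + t) powr b)"
    proof -
      have "(p / (1 + t)) powr - (q + 1) = p powr - (q + 1) * (1 + t) powr (q + 1)"
        using p t by (simp only: powr_divide powr_minus) (simp add: field_simps)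
      moreover have "(pi / (p / (1 + t))) powr b = (pi / p) powr b * (1 + t) powr b"
        using p t by (simp add: powr_mult[symmetric])
      moreover have "inverse (1 + t) = (1 + t) powr -1"
        using t by (simp add: powr_minus)
      ultimately show ?thesis by (simp add: w_def)
    qed
    \<comment> \<open>The exponents add up to 0: \<open>- (b + q)\<close> is the weight,
      \<open>- 1\<close> the Jacobian of the dilation, and \<open>q + 1\<close> and \<open>b\<close>
      come from the Laplace transform at \<open>p / (1 + t)\<close>.\<close>
    also have "(1 + t) powr - (b + q) * (1 + t) powr -1 * (1 + t) powr (q + 1) * (1 + t) powr b = 1"
      using t by (simp only: powr_add[symmetric]) simp
    finally have 1: "w * inverse (1 + t) * ((p / (1 + t)) powr - (q + 1) * (pi / (p / (1 + t))) powr b)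
       = p powr - (q + 1) * (pi / p) powr b" by simp
    have 2: "exp (- z / (4 * (p / (1 + t)))) = exp (- z / (4 * p)) * exp (- (z / (4 * p)) * t)"
      using p t by (simp add: exp_add[symmetric] field_simps)
    have "L p - w * inverse (1 + t) * L (p / (1 + t))
      = L p - Gamma (q + 1) * (w * inverse (1 + t) * ((p / (1 + t)) powr - (q + 1) * (pi / (p / (1 + t))) powr b)) * exp (- z / (4 * (p / (1 + t))))"
      by (simp add: L_def mult_ac)
    also have "\<dots> = Gamma (q + 1) * p powr - (q + 1) * (pi / p) powr b * exp (- z / (4 * p)) * (1 - exp (- (z / (4 * p)) * t))"
      unfolding 1 2 by (simp add: L_def algebra_simps)
    finally show ?thesis
      using t by (simp add: scaleR_conv_of_real mult.assoc flip: of_real_mult of_real_diff of_real_inverse)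
  qed
  ultimately show ?thesis
    using q by (simp add: fourier_trunc_power_diff b_def z_def w_def scaleR_diff_right mult.commute)
qed

text \<open>Dominated convergence along sequences: for each \<open>t\<close> the integrand is
  continuous in \<open>l\<close>, and since the mass factor grows with \<open>l\<close>, a bound
  \<open>B\<close> of the sequence gives one majorant for all its members.\<close>

lemma continuous_on_fourier_frac_trunc_power:
  fixes \<xi> :: "'a::euclidean_space"
  assumes s: "0 < s" "s < 1" and q: "q \<ge> 0"
  shows "continuous_on {0<..} (\<lambda>l. fourier (frac_trunc_power s q l) \<xi>)"
proof -
  define e where "e = real DIM('a) / 2 + q"
  have e: "e > 0" using q by (simp add: e_def add_pos_nonneg)
  define k where "k = (\<lambda>t::real. indicator {0<..} t * t powr (- 1 - s))"
  have [measurable]: "k \<in> borel_measurable borel" unfolding k_def by measurable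
  define H where "H = (\<lambda>l. \<integral>t. k t *\<^sub>R fourier (trunc_power_diff q l t) \<xi> \<partial>lborel)"
  have "continuous_on {0<..} H"
    unfolding continuous_on_sequentially
  proof (intro allI ballI impI, elim conjE)
    fix X :: "nat \<Rightarrow> real" and l :: real
    assume l: "l \<in> {0<..}" and X: "\<forall>n. X n \<in> {0<..}" "X \<longlonglongrightarrow> l"
    from X(2) have "Bseq X" by (simp add: convergentI convergent_imp_Bseq)
    then obtain B where B: "B > 0" "\<And>n. \<bar>X n\<bar> \<le> B"
      by (auto simp: Bseq_def)
    have cont: "(\<lambda>n. fourier (trunc_power q (X n * c)) \<xi>) \<longlonglongrightarrow> fourier (trunc_power q (l * c)) \<xi>" if "c > 0" for c
      using continuous_on_tendsto_compose[OF continuous_on_fourier_trunc_power[OF q, of \<xi>], of "\<lambda>n. X n * c" "l * c"]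
        X l that by (auto intro!: tendsto_intros)
    have "(\<lambda>n. \<integral>t. k t *\<^sub>R fourier (trunc_power_diff q (X n) t) \<xi> \<partial>lborel) \<longlonglongrightarrow> H l"
      unfolding H_def
    proof (rule integral_dominated_convergence)
      show "integrable lborel (\<lambda>t. k t * (1 - (1 + t) powr - e) * (2 * B powr e * mass TYPE('a) q))"
        using has_bochner_integral_powr_Marchaud[OF s e]
        unfolding k_def has_bochner_integral_iff by (intro integrable_mult_left) auto
      show "AE t in lborel. (\<lambda>n. k t *\<^sub>R fourier (trunc_power_diff q (X n) t) \<xi>) \<longlonglongrightarrow> k t *\<^sub>R fourier (trunc_power_diff q l t) \<xi>"
      proof (rule AE_I2)
        fix t :: real
        show "(\<lambda>n. k t *\<^sub>R fourier (trunc_power_diff q (X n) t) \<xi>) \<longlonglongrightarrow> k t *\<^sub>R fourier (trunc_power_diff q l t) \<xi>"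
        proof (cases "t > 0")
          case True
          then show ?thesis
            unfolding fourier_trunc_power_diff[OF q]
            using cont[of 1] by (intro tendsto_intros cont) auto
        qed (simp add: k_def)
      qed
      show "AE t in lborel. norm (k t *\<^sub>R fourier (trunc_power_diff q (X n) t) \<xi>)
          \<le> k t * (1 - (1 + t) powr - e) * (2 * B powr e * mass TYPE('a) q)" for n
      proof (rule AE_I2)
        fix t :: real
        show "norm (k t *\<^sub>R fourier (trunc_power_diff q (X n) t) \<xi>)
          \<le> k t * (1 - (1 + t) powr - e) * (2 * B powr e * mass TYPE('a) q)"
        proof (cases "t > 0")
          case True
          have "X n > 0" using X(1) by simp
          have "norm (fourier (trunc_power_diff q (X n) t) \<xi>)
            \<le> (1 - (1 + t) powr - e) * (2 * X n powr e * mass TYPE('a) q)"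
            using norm_fourier_trunc_power_diff_le[OF q \<open>X n > 0\<close>, of t \<xi>] True by (simp add: e_def)
          also have "\<dots> \<le> (1 - (1 + t) powr - e) * (2 * B powr e * mass TYPE('a) q)"
            using e \<open>X n > 0\<close> B(2)[of n] True mass_nonneg[of "TYPE('a)" q]
            by (intro mult_left_mono mult_right_mono powr_mono2)
               (auto simp: powr_minus field_simps ge_one_powr_ge_zero)
          finally show ?thesis
            using True by (simp add: k_def mult.assoc mult_left_mono)
        qed (simp add: k_def)
      qed
    qed (use q in simp_all)
    then show "(H \<circ> X) \<longlonglongrightarrow> H l"
      by (simp add: H_def comp_def)
  qed
  then have "continuous_on {0<..} (\<lambda>l. frac_coeff s q *\<^sub>R H l)"
    by (intro continuous_intros)
  then show ?thesis
    by (rule continuous_on_cong[THEN iffD1, OF refl, rotated])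
       (simp add: H_def k_def fourier_frac_trunc_power[OF s q])
qed

text \<open>The dependence of the \<open>L^1\<close> bound on \<open>l\<close> factors out as a
  power, so one constant serves all \<open>l\<close>. The uniqueness argument needs this both as
  \<open>l\<close> tends to 0 and for large \<open>l\<close>.\<close>

lemma norm_fourier_frac_trunc_power_le:
  fixes \<xi> :: "'a::euclidean_space"
  assumes s: "0 < s" "s < 1" and q: "q \<ge> 0"
  obtains K where "\<And>l. l > 0 \<Longrightarrow>
    norm (fourier (frac_trunc_power s q l) \<xi>) \<le> K * l powr (real DIM('a) / 2 + q)"
proof -
  define e where "e = real DIM('a) / 2 + q"
  have e: "e > 0" using q by (simp add: e_def add_pos_nonneg)
  define k where "k = (\<lambda>t::real. indicator {0<..} t * t powr (- 1 - s))"
  have [measurable]: "k \<in> borel_measurable borel" unfolding k_def by measurable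
  have k_fold: "indicator {0<..} t * t powr (- 1 - s) = k t" for t by (simp add: k_def)
  have int: "integrable lborel (\<lambda>t. k t * (1 - (1 + t) powr - e))"
    using has_bochner_integral_powr_Marchaud[OF s e] unfolding k_def has_bochner_integral_iff by auto
  have "norm (fourier (frac_trunc_power s q l) \<xi>)
      \<le> \<bar>frac_coeff s q\<bar> * ((\<integral>t. k t * (1 - (1 + t) powr - e) \<partial>lborel) * (2 * mass TYPE('a) q)) * l powr e"
    if l: "l > 0" for l
  proof -
    have le: "norm (k t *\<^sub>R fourier (trunc_power_diff q l t) \<xi>)
        \<le> k t * (1 - (1 + t) powr - e) * (2 * l powr e * mass TYPE('a) q)" for t
      using norm_fourier_trunc_power_diff_le[OF q l, of t \<xi>]
      by (cases "t > 0") (auto simp: k_def e_def mult.assoc mult_left_mono)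
    have int': "integrable lborel (\<lambda>t. k t * (1 - (1 + t) powr - e) * (2 * l powr e * mass TYPE('a) q))"
      using int by (intro integrable_mult_left)
    have "norm (\<integral>t. k t *\<^sub>R fourier (trunc_power_diff q l t) \<xi> \<partial>lborel)
        \<le> (\<integral>t. k t * (1 - (1 + t) powr - e) * (2 * l powr e * mass TYPE('a) q) \<partial>lborel)"
    proof (rule Bochner_Integration.integral_norm_bound_integral[OF _ int'])
      show "integrable lborel (\<lambda>t. k t *\<^sub>R fourier (trunc_power_diff q l t) \<xi>)"
        by (rule Bochner_Integration.integrable_bound[OF int'])
           (use q in \<open>auto intro!: AE_I2 order_trans[OF le[unfolded norm_scaleR real_norm_def]]\<close>)
    qed (rule le)
    then have "\<bar>frac_coeff s q\<bar> * norm (\<integral>t. k t *\<^sub>R fourier (trunc_power_diff q l t) \<xi> \<partial>lborel)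
        \<le> \<bar>frac_coeff s q\<bar> * ((\<integral>t. k t * (1 - (1 + t) powr - e) \<partial>lborel) * (2 * l powr e * mass TYPE('a) q))"
      unfolding integral_mult_left_zero by (rule mult_left_mono) simp
    then show ?thesis
      unfolding fourier_frac_trunc_power(2)[OF s q l] k_fold by (simp add: mult_ac)
  qed
  then show ?thesis
    unfolding e_def by (rule that)
qed

lemma has_bochner_integral_exp_Marchaud:
  fixes s c :: real
  assumes "0 < s" "s < 1" "c \<ge> 0"
  shows "has_bochner_integral lborel (\<lambda>t. indicator {0<..} t * t powr (- 1 - s) * (1 - exp (- c * t)))
    (c powr s * Gamma (1 - s) / s)"
  using nn_integral_exp_Marchaud[OF assms] assms
  by (intro has_bochner_integral_nn_integral)
     (auto simp: Gamma_real_nonneg indicator_def mult_ac)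

lemma trunc_power_diff_nonpos:
  "l \<le> 0 \<Longrightarrow> t > 0 \<Longrightarrow> trunc_power_diff q l t x = 0"
  by (simp add: trunc_power_diff_def trunc_power_nonpos mult_nonpos_nonneg)

text \<open>For fixed \<open>t > 0\<close> the Laplace transform is
  \<open>A * (1 - exp (- c * t))\<close>, and integrating over \<open>t\<close> produces
  \<open>c powr s\<close>, the source of the multiplier. What remains is the Laplace transform
  belonging to the exponent \<open>q + s\<close>.\<close>

lemma laplace_fourier_frac_trunc_power:
  fixes \<xi> :: "'a::euclidean_space"
  assumes s: "0 < s" "s < 1" and q: "q \<ge> 0" and p: "p > 0"
  shows "has_bochner_integral lborel
      (\<lambda>l. indicator {0<..} l *\<^sub>R (exp (- p * l) *\<^sub>R fourier (frac_trunc_power s q l) \<xi>))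
    (of_real (norm \<xi> powr (2 * s)) * of_real (Gamma (q + s + 1) * p powr - (q + s + 1) * ((pi / p) powr (real DIM('a) / 2)
       * exp (- (norm \<xi>)\<^sup>2 / (4 * p)))))"
proof -
  define e where "e = real DIM('a) / 2 + q"
  have e: "e > 0" using q by (simp add: e_def add_pos_nonneg)
  define c where "c = (norm \<xi>)\<^sup>2 / (4 * p)"
  have c: "c \<ge> 0" using p by (simp add: c_def)
  define A where "A = Gamma (q + 1) * p powr - (q + 1) * (pi / p) powr (real DIM('a) / 2) * exp (- c)"
  define k where "k = (\<lambda>t::real. indicator {0<..} t * t powr (- 1 - s))"
  have k0: "k t \<ge> 0" for t by (simp add: k_def)
  have [measurable]: "k \<in> borel_measurable borel" unfolding k_def by measurable
  have k_fold: "indicator {0<..} t * t powr (- 1 - s) = k t" for t by (simp add: k_def)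
  define F where "F = (\<lambda>t l. k t *\<^sub>R (exp (- p * l) *\<^sub>R fourier (trunc_power_diff q l t) \<xi>))"
  have L: "has_bochner_integral lborel (\<lambda>l. exp (- p * l) *\<^sub>R fourier (trunc_power_diff q l t) \<xi>)
      (of_real (A * (1 - exp (- c * t))))" if "t > 0" for t
    using laplace_fourier_trunc_power_diff[OF q p, of t \<xi>] that by (simp add: A_def c_def mult.assoc)
  have F_L: "has_bochner_integral lborel (F t) (of_real (A * (k t * (1 - exp (- c * t)))))" for t
  proof (cases "t > 0")
    case True
    then show ?thesis
      using has_bochner_integral_scaleR_right[OF L[OF True], of "k t"]
      by (simp add: F_def scaleR_conv_of_real mult_ac)
  qed (simp add: F_def k_def has_bochner_integral_zero)
  define w where "w = (\<lambda>l. indicator {0<..} l * (l powr ((e + 1) - 1) * exp (- p * l)))"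
  have int_w: "integrable lborel w"
    using nn_integral_powr_exp[of "e + 1" p] e p
    by (intro integrable.intros[OF has_bochner_integral_nn_integral])
       (auto simp: w_def Gamma_real_nonneg has_bochner_integral_iff)
  \<comment> \<open>The majorant is a product of a function of \<open>t\<close> and a function of
    \<open>l\<close>, so the integrability needed for Fubini splits into two one-dimensional
    integrals.\<close>
  have F_le: "norm (F t l) \<le> k t * (1 - (1 + t) powr - e) * (2 * mass TYPE('a) q) * w l" for t l
  proof (cases "t > 0")
    case t: True
    show ?thesis
    proof (cases "l > 0")
      case True
      have "norm (fourier (trunc_power_diff q l t) \<xi>) \<le> (1 - (1 + t) powr - e) * (2 * l powr e * mass TYPE('a) q)"
        using norm_fourier_trunc_power_diff_le[OF q True, of t \<xi>] t by (simp add: e_def)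
      then have "k t * (exp (- p * l) * norm (fourier (trunc_power_diff q l t) \<xi>))
        \<le> k t * (exp (- p * l) * ((1 - (1 + t) powr - e) * (2 * l powr e * mass TYPE('a) q)))"
        by (intro mult_left_mono) (auto simp: k0)
      then show ?thesis
        using True by (simp add: F_def k0 w_def mult_ac)
    next
      case False
      then show ?thesis
        using t by (simp add: F_def w_def trunc_power_diff_nonpos fourier_def)
    qed
  qed (simp add: F_def k_def)
  have int: "integrable (lborel \<Otimes>\<^sub>M lborel) (case_prod F)"
  proof (rule lborel_pair.Fubini_integrable)
    show meas: "case_prod F \<in> borel_measurable (lborel \<Otimes>\<^sub>M lborel)"
      unfolding F_def using q by measurable
    have [measurable]: "case_prod F \<in> borel_measurable (borel \<Otimes>\<^sub>M borel)"
      using meas by simp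
    show "integrable lborel (\<lambda>t. \<integral>l. norm (case_prod F (t, l)) \<partial>lborel)"
    proof (rule Bochner_Integration.integrable_bound)
      show "integrable lborel (\<lambda>t. k t * (1 - (1 + t) powr - e) * (2 * mass TYPE('a) q) * (\<integral>l. w l \<partial>lborel))"
        using has_bochner_integral_powr_Marchaud[OF s e]
        unfolding k_def has_bochner_integral_iff by (intro integrable_mult_left) auto
      have "(\<integral>l. norm (F t l) \<partial>lborel)
          \<le> (\<integral>l. k t * (1 - (1 + t) powr - e) * (2 * mass TYPE('a) q) * w l \<partial>lborel)" for t
        using F_L[of t] F_le[of t] int_w
        by (intro integral_mono integrable_norm integrable_mult_right) (auto simp: has_bochner_integral_iff)
      then show "AE t in lborel. norm (\<integral>l. norm (case_prod F (t, l)) \<partial>lborel)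
          \<le> norm (k t * (1 - (1 + t) powr - e) * (2 * mass TYPE('a) q) * (\<integral>l. w l \<partial>lborel))"
        by (intro AE_I2) (simp add: order_trans[OF _ abs_ge_self])
    qed simp
    show "AE t in lborel. integrable lborel (\<lambda>l. case_prod F (t, l))"
      using F_L by (intro AE_I2) (auto simp: has_bochner_integral_iff)
  qed
  have inner: "frac_coeff s q *\<^sub>R (\<integral>t. F t l \<partial>lborel)
      = indicator {0<..} l *\<^sub>R (exp (- p * l) *\<^sub>R fourier (frac_trunc_power s q l) \<xi>)" for l
  proof (cases "l > 0")
    case True
    have "(\<integral>t. F t l \<partial>lborel) = exp (- p * l) *\<^sub>R (\<integral>t. k t *\<^sub>R fourier (trunc_power_diff q l t) \<xi> \<partial>lborel)"
      unfolding F_def by (subst integral_scaleR_right[symmetric]) (simp only: scaleR_left_commute)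
    then show ?thesis
      unfolding fourier_frac_trunc_power(2)[OF s q True] k_fold using True by simp
  next
    case False
    then have "F t l = 0" for t
      by (cases "t > 0") (auto simp: F_def k_def trunc_power_diff_nonpos fourier_def)
    with False show ?thesis by simp
  qed
  have int': "integrable lborel (\<lambda>l. frac_coeff s q *\<^sub>R (\<integral>t. F t l \<partial>lborel))"
    using lborel_pair.integrable_snd[of F] int by simp
  have Fub: "(\<integral>l. (\<integral>t. F t l \<partial>lborel) \<partial>lborel) = (\<integral>t. (\<integral>l. F t l \<partial>lborel) \<partial>lborel)"
    by (rule lborel_pair.Fubini_integral[OF int])
  have val: "(\<integral>t. (\<integral>l. F t l \<partial>lborel) \<partial>lborel) = of_real (A * (c powr s * Gamma (1 - s) / s))"
  proof -
    have "(\<integral>l. F t l \<partial>lborel) = of_real (A * (k t * (1 - exp (- c * t))))" for t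
      using F_L[of t] by (simp add: has_bochner_integral_iff)
    then show ?thesis
      using has_bochner_integral_exp_Marchaud[OF s c]
      by (simp add: has_bochner_integral_iff k_def del: of_real_mult of_real_diff)
  qed
  have const: "frac_coeff s q * (A * (c powr s * Gamma (1 - s) / s))
      = norm \<xi> powr (2 * s) * (Gamma (q + s + 1) * p powr - (q + s + 1) * ((pi / p) powr (real DIM('a) / 2)
       * exp (- (norm \<xi>)\<^sup>2 / (4 * p))))"
  proof -
    have "(norm \<xi>)\<^sup>2 powr s = (norm \<xi> powr 2) powr s"
      by simp
    also have "\<dots> = norm \<xi> powr (2 * s)"
      by (rule powr_powr)
    \<comment> \<open>\<open>4 powr s\<close> removes the 4 in \<open>c\<close>; the remaining
      \<open>p powr - s\<close> moves the Laplace exponent from \<open>q + 1\<close> to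
      \<open>q + s + 1\<close>.\<close>
    finally have "4 powr s * c powr s = norm \<xi> powr (2 * s) * p powr - s"
      using p by (simp add: c_def powr_divide powr_mult powr_minus field_simps)
    moreover have "p powr - (q + s + 1) = p powr - (q + 1) * p powr - s"
      by (simp add: powr_add[symmetric] algebra_simps)
    moreover have "frac_coeff s q * (A * (c powr s * Gamma (1 - s) / s)) = (4 powr s * c powr s)
       * (Gamma (q + s + 1) * (p powr - (q + 1) * (pi / p) powr (real DIM('a) / 2) * exp (- c)))"
    proof -
      define g h where "g = Gamma (q + 1)" and "h = Gamma (1 - s)"
      have "g > 0" "h > 0"
        using q s by (simp_all add: g_def h_def)
      then show ?thesis
        using s unfolding frac_coeff_def A_def g_def[symmetric] h_def[symmetric] by simp
    qed
    ultimately show ?thesis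
      by (simp add: c_def)
  qed
  have "(\<integral>l. frac_coeff s q *\<^sub>R (\<integral>t. F t l \<partial>lborel) \<partial>lborel)
      = of_real (frac_coeff s q * (A * (c powr s * Gamma (1 - s) / s)))"
    unfolding integral_scaleR_right Fub val by (simp only: scaleR_conv_of_real of_real_mult)
  with int' show ?thesis
    unfolding inner[symmetric] has_bochner_integral_iff const by (simp only: of_real_mult simp_thms)
qed

lemma has_frac_laplacian_trunc_power:
  assumes s: "0 < s" "s < 1" and q: "q \<ge> 0" and l: "l > 0"
  shows "has_frac_laplacian s (trunc_power (q + s) l :: 'a::euclidean_space \<Rightarrow> real) (frac_trunc_power s q l)"
  unfolding has_frac_laplacian_def
proof (intro conjI allI)
  show "integrable lborel (trunc_power (q + s) l :: 'a \<Rightarrow> real)"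
    using s q by (intro integrable_trunc_power) auto
  show "integrable lborel (frac_trunc_power s q l :: 'a \<Rightarrow> real)"
    by (rule fourier_frac_trunc_power(1)[OF s q l])
  fix \<xi> :: 'a
  define e where "e = real DIM('a) / 2 + q"
  have e: "e > 0" using q by (simp add: e_def add_pos_nonneg)
  define r where "r = norm \<xi> powr (2 * s)"
  have r: "r \<ge> 0" by (simp add: r_def)
  define f where "f = (\<lambda>l. fourier (frac_trunc_power s q l) \<xi> - r *\<^sub>R fourier (trunc_power (q + s) l) \<xi>)"
  obtain K where K: "\<And>l. l > 0 \<Longrightarrow> norm (fourier (frac_trunc_power s q l) \<xi>) \<le> K * l powr e"
    using norm_fourier_frac_trunc_power_le[OF s q, of \<xi>] by (auto simp: e_def)
  define M where "M = mass TYPE('a) (q + s)"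
  \<comment> \<open>Both exponents are positive, as \<open>e\<close> contains half the dimension, so
    the bound tends to 0 with \<open>l\<close>; for large \<open>l\<close> its growth is beaten by
    \<open>exp (- l)\<close>.\<close>
  have f_le: "norm (f l) \<le> K * l powr e + r * (l powr (e + s) * M)" if "l > 0" for l
  proof -
    have "norm (fourier (trunc_power (q + s) l) \<xi>) \<le> l powr (e + s) * M"
      using norm_fourier_trunc_power_le[of "q + s" l \<xi>] that s q by (simp add: M_def e_def add.assoc)
    then have "norm (r *\<^sub>R fourier (trunc_power (q + s) l) \<xi>) \<le> r * (l powr (e + s) * M)"
      using r by (simp add: mult_left_mono)
    then show ?thesis
      unfolding f_def using K[OF that] norm_triangle_ineq4 by (smt (verit))
  qed
  have "f l = 0"
  proof (rule laplace_eq_0_imp_eq_0[OF _ _ _ _ l])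
    show "continuous_on {0<..} f"
      unfolding f_def using s q
      by (intro continuous_intros continuous_on_fourier_frac_trunc_power continuous_on_fourier_trunc_power) auto
    show "(f \<longlongrightarrow> 0) (at_right 0)"
    proof (rule Lim_null_comparison)
      show "\<forall>\<^sub>F l in at_right 0. norm (f l) \<le> K * l powr e + r * (l powr (e + s) * M)"
        using eventually_at_right_less[of 0] by eventually_elim (rule f_le)
      show "((\<lambda>l. K * l powr e + r * (l powr (e + s) * M)) \<longlongrightarrow> 0) (at_right 0)"
      proof -
        have "((\<lambda>l. l powr a) \<longlongrightarrow> 0) (at_right 0)" if "a > 0" for a :: real
          using that by real_asymp
        then have "((\<lambda>l. K * l powr e + r * (l powr (e + s) * M)) \<longlongrightarrow> K * 0 + r * (0 * M)) (at_right 0)"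
          using e s by (intro tendsto_add tendsto_mult tendsto_const) auto
        then show ?thesis by simp
      qed
    qed
    show "((\<lambda>l. exp (- l) *\<^sub>R f l) \<longlongrightarrow> 0) at_top"
    proof (rule Lim_null_comparison)
      show "\<forall>\<^sub>F l in at_top. norm (exp (- l) *\<^sub>R f l) \<le> K * (exp (- l) * l powr e) + r * ((exp (- l) * l powr (e + s)) * M)"
        using eventually_gt_at_top[of 0]
      proof eventually_elim
        case (elim l)
        have "exp (- l) * norm (f l) \<le> exp (- l) * (K * l powr e + r * (l powr (e + s) * M))"
          by (intro mult_left_mono f_le elim) simp
        then show ?case by (simp add: algebra_simps)
      qed
      show "((\<lambda>l. K * (exp (- l) * l powr e) + r * ((exp (- l) * l powr (e + s)) * M)) \<longlongrightarrow> 0) at_top"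
      proof -
        have "((\<lambda>l. exp (- l) * l powr a) \<longlongrightarrow> 0) at_top" if "a > 0" for a :: real
          using that by real_asymp
        then have "((\<lambda>l. K * (exp (- l) * l powr e) + r * ((exp (- l) * l powr (e + s)) * M)) \<longlongrightarrow> K * 0 + r * (0 * M)) at_top"
          using e s by (intro tendsto_add tendsto_mult[OF tendsto_const] tendsto_mult[OF _ tendsto_const]) auto
        then show ?thesis by simp
      qed
    qed
    fix p :: real assume p: "p > 0"
    have "has_bochner_integral lborel (\<lambda>l. exp (- p * l) *\<^sub>R fourier (trunc_power (q + s) l) \<xi>)
       (of_real (Gamma (q + s + 1) * p powr - (q + s + 1) * ((pi / p) powr (real DIM('a) / 2)
       * exp (- (norm \<xi>)\<^sup>2 / (4 * p)))))"
      using s q by (intro laplace_fourier_trunc_power p) auto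
    note has_bochner_integral_scaleR_right[OF this, of r]
    from has_bochner_integral_diff[OF laplace_fourier_frac_trunc_power[OF s q p, of \<xi>] this]
    have "has_bochner_integral lborel (\<lambda>l. indicator {0<..} l *\<^sub>R (exp (- p * l) *\<^sub>R fourier (frac_trunc_power s q l) \<xi>)
        - r *\<^sub>R (exp (- p * l) *\<^sub>R fourier (trunc_power (q + s) l) \<xi>)) 0"
      by (simp add: r_def scaleR_conv_of_real)
    moreover have "indicator {0<..} l *\<^sub>R (exp (- p * l) *\<^sub>R fourier (frac_trunc_power s q l) \<xi>)
        - r *\<^sub>R (exp (- p * l) *\<^sub>R fourier (trunc_power (q + s) l) \<xi>)
      = indicator {0<..} l *\<^sub>R (exp (- p * l) *\<^sub>R f l)" for l
      by (cases "l > 0") (auto simp: f_def scaleR_diff_right scaleR_left_commute trunc_power_nonpos fourier_def)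
    ultimately show "has_bochner_integral lborel (\<lambda>l. indicator {0<..} l *\<^sub>R (exp (- p * l) *\<^sub>R f l)) 0"
      by simp
  qed
  then show "fourier (frac_trunc_power s q l) \<xi> = of_real (norm \<xi> powr (2 * s)) * fourier (trunc_power (q + s) l) \<xi>"
    by (simp add: f_def r_def scaleR_conv_of_real)
qed

section \<open>Explicit values inside the ball\<close>

lemma Gamma_real_plus1: "x > 0 \<Longrightarrow> Gamma (x + 1) = x * Gamma (x :: real)"
  by (rule Gamma_plus1) (auto elim!: nonpos_Ints_cases)

text \<open>A point of the ball of squared radius \<open>l\<close> lies in every larger ball, so at
  exponent 0 both truncated powers equal 1 and the integrand no longer depends on \<open>x\<close>.
  The division by \<open>1 + s\<close> arises because \<open>kappa_const\<close> contains
  \<open>Gamma (s + 2)\<close> where the integral gives \<open>Gamma (s + 1)\<close>.\<close>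

lemma frac_trunc_power_0_in_ball:
  fixes x :: "'a::euclidean_space"
  assumes s: "0 < s" "s < 1" and x: "(norm x)\<^sup>2 < l"
  shows "frac_trunc_power s 0 l x = kappa_const s DIM('a) / (1 + s)"
proof -
  define b where "b = real DIM('a) / 2"
  have b: "b > 0" by (simp add: b_def)
  have "l > 0" using x by (smt (verit) zero_le_power2)
  have eq: "indicator {0<..} t * t powr (- 1 - s) * trunc_power_diff 0 l t x
      = indicator {0<..} t * t powr (- 1 - s) * (1 - (1 + t) powr - b)" for t
  proof (cases "t > 0")
    case True
    then have "l * t > 0" using \<open>l > 0\<close> by simp
    then have "(norm x)\<^sup>2 < l * (1 + t)" using x by (simp add: algebra_simps)
    then show ?thesis using x by (simp add: trunc_power_diff_def trunc_power_def b_def)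
  qed simp
  have "frac_trunc_power s 0 l x = frac_coeff s 0 * (Gamma (b + s) * Gamma (1 - s) / (s * Gamma b))"
    unfolding frac_trunc_power_def eq
    using has_bochner_integral_powr_Marchaud[OF s b] by (simp add: has_bochner_integral_iff)
  also have "\<dots> = 4 powr s * Gamma (s + 1) * Gamma (s + b) / Gamma b"
  proof -
    define h where "h = Gamma (1 - s)"
    have "h > 0" using s by (simp add: h_def)
    then show ?thesis using s unfolding frac_coeff_def h_def[symmetric] by (simp add: add.commute)
  qed
  also have "\<dots> = kappa_const s DIM('a) / (1 + s)"
  proof -
    have "Gamma (s + 2) = (s + 1) * Gamma (s + 1)"
      using s Gamma_real_plus1[of "s + 1"] by (simp add: add.assoc)
    moreover have "(4::real) powr s = 2 powr (2 * s)"
      using powr_powr[of 2 2 s] by simp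
    ultimately have "kappa_const s DIM('a) = (s + 1) * (4 powr s * Gamma (s + 1) * Gamma (s + b) / Gamma b)"
      unfolding kappa_const_def b_def[symmetric] by (simp add: mult_ac)
    then show ?thesis
      using s by (simp add: add.commute)
  qed
  finally show ?thesis .
qed

text \<open>At exponent 1 the truncated powers are affine in \<open>(norm x)\<^sup>2\<close> inside
  the ball, so the integrand combines two Marchaud integrands, for \<open>b = d / 2\<close> and for
  \<open>b + 1\<close>. The ratio of their integrals is \<open>(b + s) / b\<close>, which is
  \<open>gamma_const\<close>.\<close>

lemma frac_trunc_power_1_in_ball:
  fixes x :: "'a::euclidean_space"
  assumes s: "0 < s" "s < 1" and x: "(norm x)\<^sup>2 < l"
  shows "frac_trunc_power s 1 l x = kappa_const s DIM('a) * (l - gamma_const s DIM('a) * (norm x)\<^sup>2)"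
proof -
  define b where "b = real DIM('a) / 2"
  have b: "b > 0" by (simp add: b_def)
  have "l > 0" using x by (smt (verit) zero_le_power2)
  define k where "k = (\<lambda>t::real. indicator {0<..} t * t powr (- 1 - s))"
  define I where "I = (\<lambda>b. Gamma (b + s) * Gamma (1 - s) / (s * Gamma b))"
  have I: "has_bochner_integral lborel (\<lambda>t. k t * (1 - (1 + t) powr - b)) (I b)" if "b > 0" for b
    unfolding k_def I_def by (rule has_bochner_integral_powr_Marchaud[OF s that])
  have eq: "k t * trunc_power_diff 1 l t x
      = l * (k t * (1 - (1 + t) powr - b)) - (norm x)\<^sup>2 * (k t * (1 - (1 + t) powr - (b + 1)))" for t
  proof (cases "t > 0")
    case True
    then have "l * t > 0" using \<open>l > 0\<close> by simp
    then have "(norm x)\<^sup>2 < l * (1 + t)" using x by (simp add: algebra_simps)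
    moreover have "(1 + t) powr - (b + 1) * (1 + t) powr 1 = (1 + t) powr - b"
      by (simp only: powr_add[symmetric]) simp
    then have "(1 + t) powr - (b + 1) * (1 + t) = (1 + t) powr - b"
      using True by simp
    ultimately have D: "trunc_power_diff 1 l t x = (l - (norm x)\<^sup>2) - (l * (1 + t) powr - b - (1 + t) powr - (b + 1) * (norm x)\<^sup>2)"
      using x by (simp add: trunc_power_diff_def trunc_power_def b_def right_diff_distrib mult.left_commute)
    show ?thesis unfolding D by (simp add: algebra_simps)
  qed (simp add: k_def)
  have "has_bochner_integral lborel (\<lambda>t. k t * trunc_power_diff 1 l t x) (l * I b - (norm x)\<^sup>2 * I (b + 1))"
    unfolding eq using b by (intro has_bochner_integral_diff has_bochner_integral_mult_right I) auto
  then have "frac_trunc_power s 1 l x = frac_coeff s 1 * (l * I b - (norm x)\<^sup>2 * I (b + 1))"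
    unfolding frac_trunc_power_def by (simp add: has_bochner_integral_iff k_def)
  also have "I (b + 1) = gamma_const s DIM('a) * I b"
  proof -
    have "Gamma (b + 1 + s) = (b + s) * Gamma (b + s)"
      using Gamma_real_plus1[of "b + s"] b s by (simp add: add.assoc add.commute[of s 1])
    moreover have "Gamma (b + 1) = b * Gamma b"
      using Gamma_real_plus1[of b] b by simp
    moreover have "gamma_const s DIM('a) = (b + s) / b"
      by (simp add: gamma_const_def b_def field_simps)
    ultimately show ?thesis by (simp add: I_def mult_ac)
  qed
  also have "frac_coeff s 1 * (l * I b - (norm x)\<^sup>2 * (gamma_const s DIM('a) * I b))
      = frac_coeff s 1 * I b * (l - gamma_const s DIM('a) * (norm x)\<^sup>2)"
    by (simp add: algebra_simps)
  also have "frac_coeff s 1 * I b = kappa_const s DIM('a)"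
  proof -
    define h where "h = Gamma (1 - s)"
    have "h > 0" using s by (simp add: h_def)
    moreover have "(4::real) powr s = 2 powr (2 * s)"
      using powr_powr[of 2 2 s] by simp
    moreover have "Gamma (2::real) = 1"
      using Gamma_numeral[of "num.Bit0 num.One", where 'a = real] by (simp add: fact_numeral)
    ultimately show ?thesis
      using s unfolding frac_coeff_def I_def kappa_const_def b_def[symmetric] h_def[symmetric] by (simp add: add_ac)
  qed
  finally show ?thesis .
qed

section \<open>The classical Laplacian of the profile\<close>

text \<open>The delicate point is \<open>z = 0\<close>, where the difference quotient is at most
  \<open>|h| powr (p - 1)\<close> in absolute value. The exponents \<open>2 + s\<close> and
  \<open>1 + s\<close> both exceed 1, so the profile can be differentiated twice at every point, the
  sphere included.\<close>

lemma has_real_derivative_max_0_powr: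
  fixes z p :: real
  assumes "p > 1"
  shows "((\<lambda>z. max 0 z powr p) has_real_derivative p * max 0 z powr (p - 1)) (at z)"
proof -
  consider "z > 0" | "z < 0" | "z = 0" by linarith
  then show ?thesis
  proof cases
    case 1
    have "((\<lambda>z. z powr p) has_real_derivative p * max 0 z powr (p - 1)) (at z)"
      using 1 by (auto intro!: derivative_eq_intros)
    moreover have "\<forall>\<^sub>F w in nhds z. w powr p = max 0 w powr p"
      using eventually_nhds_in_open[of "{0<..}" z] 1 by (auto elim!: eventually_mono)
    ultimately show ?thesis
      by (subst DERIV_cong_ev[OF refl _ refl, symmetric])
  next
    case 2
    have "((\<lambda>z. 0) has_real_derivative p * max 0 z powr (p - 1)) (at z)"
      using 2 by simp
    moreover have "\<forall>\<^sub>F w in nhds z. 0 = max 0 w powr p"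
      using eventually_nhds_in_open[of "{..<0}" z] 2 by (auto elim!: eventually_mono)
    ultimately show ?thesis
      by (subst DERIV_cong_ev[OF refl _ refl, symmetric])
  next
    case 3
    have "((\<lambda>h. max 0 h powr p / h) \<longlongrightarrow> 0) (at 0)"
    proof (rule Lim_null_comparison)
      show "\<forall>\<^sub>F h in at 0. norm (max 0 h powr p / h) \<le> \<bar>h\<bar> powr (p - 1)"
      proof (intro always_eventually allI)
        fix h :: real
        show "norm (max 0 h powr p / h) \<le> \<bar>h\<bar> powr (p - 1)"
        proof (cases "h > 0")
          case True
          then show ?thesis by (simp add: powr_diff)
        qed (simp add: max_def)
      qed
      have "((\<lambda>h::real. \<bar>h\<bar> powr (p - 1)) \<longlongrightarrow> \<bar>0\<bar> powr (p - 1)) (at 0)"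
        using assms by (intro tendsto_powr' tendsto_intros) auto
      then show "((\<lambda>h::real. \<bar>h\<bar> powr (p - 1)) \<longlongrightarrow> 0) (at 0)"
        by simp
    qed
    then show ?thesis
      using 3 assms by (simp add: DERIV_def)
  qed
qed

lemma neg_laplacian_V_profile:
  fixes y :: "'a::euclidean_space"
  assumes s: "s > 0" and a: "a > 0" and l: "l > 0"
  shows "- laplacian (V_profile s (a * l) a) y = (2 + s) * a powr (2 + s) *
    (mu_const s DIM('a) * trunc_power (1 + s) l y - 4 * (1 + s) * l * trunc_power s l y)"
proof -
  define m where "m = max 0 (a * l - a * (norm y)\<^sup>2)"
  have d2: "(deriv ^^ 2) (\<lambda>t. V_profile s (a * l) a (y + t *\<^sub>R b)) 0
     = (2 + s) * (1 + s) * m powr s * (2 * a * (y \<bullet> b))\<^sup>2 - 2 * a * (2 + s) * m powr (1 + s)"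
    if b: "b \<in> Basis" for b
  proof -
    define q where "q = (\<lambda>t. a * l - a * ((norm y)\<^sup>2 + 2 * t * (y \<bullet> b) + t\<^sup>2))"
    have q': "(q has_real_derivative (- 2 * a * (y \<bullet> b + t))) (at t)" for t
      unfolding q_def by (auto intro!: derivative_eq_intros simp: algebra_simps)
    have V: "V_profile s (a * l) a (y + t *\<^sub>R b) = max 0 (q t) powr (2 + s)" for t
    proof -
      have "(norm (y + t *\<^sub>R b))\<^sup>2 = (norm y)\<^sup>2 + 2 * t * (y \<bullet> b) + t\<^sup>2"
        unfolding power2_norm_eq_inner using b
        by (simp add: inner_add_left inner_add_right inner_commute[of b y] power2_eq_square ring_distribs)
      then show ?thesis by (simp add: V_profile_def q_def)
    qed
    have pow: "((\<lambda>t. max 0 (q t) powr p) has_real_derivative p * max 0 (q t) powr (p - 1) * (- 2 * a * (y \<bullet> b + t))) (at t)"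
      if "p > 1" for p t
      by (rule DERIV_chain2[OF has_real_derivative_max_0_powr[OF that] q'])
    have e: "2 + s - 1 = 1 + s" "1 + s - 1 = s" "2 + s > 1" "1 + s > 1"
      using s by simp_all
    have "deriv (\<lambda>t. max 0 (q t) powr (2 + s)) t = (2 + s) * max 0 (q t) powr (1 + s) * (- 2 * a * (y \<bullet> b + t))" for t
      by (rule DERIV_imp_deriv[OF pow[OF e(3), of t, unfolded e]])
    then have "deriv (\<lambda>t. V_profile s (a * l) a (y + t *\<^sub>R b)) = (\<lambda>t. (2 + s) * (max 0 (q t) powr (1 + s) * (- 2 * a * (y \<bullet> b + t))))"
      unfolding V by (auto simp: mult.assoc)
    moreover have "((\<lambda>t. (2 + s) * (max 0 (q t) powr (1 + s) * (- 2 * a * (y \<bullet> b + t)))) has_real_derivative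
       (2 + s) * (((1 + s) * max 0 (q 0) powr s * (- 2 * a * (y \<bullet> b + 0))) * (- 2 * a * (y \<bullet> b + 0)) + (- 2 * a) * max 0 (q 0) powr (1 + s))) (at 0)"
      by (intro DERIV_cmult DERIV_mult pow[OF e(4), of 0, unfolded e]) (auto intro!: derivative_eq_intros)
    ultimately have "(deriv ^^ 2) (\<lambda>t. V_profile s (a * l) a (y + t *\<^sub>R b)) 0
       = (2 + s) * (((1 + s) * max 0 (q 0) powr s * (- 2 * a * (y \<bullet> b + 0))) * (- 2 * a * (y \<bullet> b + 0)) + (- 2 * a) * max 0 (q 0) powr (1 + s))"
      by (simp add: numeral_2_eq_2 DERIV_imp_deriv)
    moreover have "max 0 (q 0) = m" by (simp add: q_def m_def)
    ultimately show ?thesis by (simp add: power2_eq_square algebra_simps)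
  qed
  have nsq: "(norm y)\<^sup>2 = (\<Sum>b\<in>Basis. (y \<bullet> b)\<^sup>2)"
    by (simp only: power2_norm_eq_inner euclidean_inner[of y y]) (simp add: power2_eq_square)
  have pow_m: "m powr r = a powr r * trunc_power r l y" if "r > 0" for r
  proof -
    have "m = (if (norm y)\<^sup>2 < l then a * (l - (norm y)\<^sup>2) else 0)"
      using a by (auto simp: m_def right_diff_distrib[symmetric] zero_le_mult_iff max_def)
    then show ?thesis using a that by (simp add: trunc_power_def powr_mult)
  qed
  \<comment> \<open>On the support \<open>(norm y)\<^sup>2\<close> is \<open>l\<close> minus the
    base of the power. This removes the quadratic factor left by the second derivatives and puts
    \<open>4 * (1 + s)\<close> into \<open>mu_const\<close>.\<close>
  have lower: "trunc_power s l y * (norm y)\<^sup>2 = l * trunc_power s l y - trunc_power (1 + s) l y"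
    by (simp add: trunc_power_def powr_add algebra_simps)
  have "laplacian (V_profile s (a * l) a) y
     = (2 + s) * (1 + s) * m powr s * (4 * a\<^sup>2 * (norm y)\<^sup>2) - real DIM('a) * (2 * a * (2 + s) * m powr (1 + s))"
    unfolding laplacian_def nsq
    by (simp add: d2 sum_subtractf sum_distrib_left power_mult_distrib mult_ac)
  also have "\<dots> = (2 + s) * (a\<^sup>2 * a powr s) * (4 * (1 + s) * (trunc_power s l y * (norm y)\<^sup>2)
      - 2 * real DIM('a) * trunc_power (1 + s) l y)"
  proof -
    have "m powr (1 + s) = a * a powr s * trunc_power (1 + s) l y"
      using pow_m[of "1 + s"] s a by (simp add: powr_add)
    then show ?thesis
      by (simp only: pow_m[OF s]) (simp add: power2_eq_square algebra_simps)
  qed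
  also have "a\<^sup>2 * a powr s = a powr (2 + s)"
    using a by (simp add: powr_add)
  finally show ?thesis
    unfolding lower by (simp add: mu_const_def algebra_simps)
qed

section \<open>Assembly of the solution\<close>

lemma has_frac_laplacian_linear:
  assumes "has_frac_laplacian s f g" "has_frac_laplacian s f' g'"
  shows "has_frac_laplacian s (\<lambda>x. c * f x - c' * f' x) (\<lambda>x. c * g x - c' * g' x)"
proof -
  have lin: "fourier (\<lambda>x. c * h x - c' * h' x) \<xi> = of_real c * fourier h \<xi> - of_real c' * fourier h' \<xi>"
    if "integrable lborel h" "integrable lborel h'" for h h' :: "'a \<Rightarrow> real" and \<xi>
  proof -
    have "fourier (\<lambda>x. k * h x) \<xi> = of_real k * fourier h \<xi>" for k and h :: "'a \<Rightarrow> real"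
      by (simp add: fourier_def mult.assoc)
    then show ?thesis using that by (subst fourier_diff) auto
  qed
  show ?thesis
    using assms unfolding has_frac_laplacian_def by (auto simp: lin algebra_simps)
qed

theorem theorem6p1:
  fixes s :: real
  assumes "0 < s" and "s < 1"
  defines "d \<equiv> DIM('a::euclidean_space)"
  shows "\<exists>a>0.
    a powr (- (2 + s)) =
      2 * (2 + s) * (real d + 4 + 2 * s) * gamma_const s d * mu_const s d * kappa_const s d \<and>
    (\<forall>A>0.
      (\<forall>y\<in>ball (0::'a) (sqrt (A / a)). V_profile s A a y > 0) \<and>
      solves_profile_problem s (sqrt (A / a)) (c_const s d a * A) (V_profile s A a :: 'a \<Rightarrow> real))"
proof -
  note s = assms(1,2)
  define g m k where "g = gamma_const s d" and "m = mu_const s d" and "k = kappa_const s d"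
  have d: "d > 0" by (simp add: d_def)
  have pos: "g > 0" "m > 0" "k > 0"
    using s d by (auto simp: g_def m_def k_def gamma_const_def mu_const_def kappa_const_def
        intro!: add_pos_nonneg divide_pos_pos mult_pos_pos Gamma_real_pos)
  define X where "X = 2 * (2 + s) * (real d + 4 + 2 * s) * g * m * k"
  have X: "X > 0" using s pos d by (simp add: X_def)
  \<comment> \<open>The root of the prescribed equation for \<open>a\<close>, whose right-hand side
    \<open>X\<close> is positive.\<close>
  define a where "a = X powr (- (1 / (2 + s)))"
  have a: "a > 0" using X by (simp add: a_def)
  have aX: "a powr (- (2 + s)) = X"
  proof -
    have "- (1 / (2 + s)) * - (2 + s) = 1" using s by (simp add: field_simps)
    then show ?thesis using X by (simp only: a_def powr_powr) simp
  qed
  have aX': "a powr (2 + s) = 1 / X"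
    by (metis aX powr_minus inverse_eq_divide inverse_inverse_eq)
  have "(\<forall>y\<in>ball (0::'a) (sqrt (A / a)). V_profile s A a y > 0) \<and>
      solves_profile_problem s (sqrt (A / a)) (c_const s d a * A) (V_profile s A a :: 'a \<Rightarrow> real)"
    if A: "A > 0" for A
  proof -
    define l where "l = A / a"
    have l: "l > 0" "A = a * l" using A a by (simp_all add: l_def)
    have ball: "y \<in> ball 0 (sqrt l) \<longleftrightarrow> (norm y)\<^sup>2 < l" for y :: 'a
      using real_sqrt_less_iff[of "(norm y)\<^sup>2" l] by simp
    have sign: "A - a * (norm y)\<^sup>2 > 0 \<longleftrightarrow> (norm y)\<^sup>2 < l" for y :: 'a
      using a by (simp add: l(2) right_diff_distrib[symmetric] zero_less_mult_iff)
    define c c' where "c = (2 + s) * a powr (2 + s) * m" and "c' = (2 + s) * a powr (2 + s) * (4 * (1 + s) * l)"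
    define W :: "'a \<Rightarrow> real" where "W = (\<lambda>y. c * frac_trunc_power s 1 l y - c' * frac_trunc_power s 0 l y)"
    \<comment> \<open>The exponents are read as \<open>q + s\<close> with \<open>q = 1\<close> and
      \<open>q = 0\<close>, hence the form \<open>0 + s\<close>.\<close>
    have "has_frac_laplacian s (\<lambda>y::'a. c * trunc_power (1 + s) l y - c' * trunc_power (0 + s) l y) W"
      unfolding W_def using s l
      by (intro has_frac_laplacian_linear has_frac_laplacian_trunc_power) auto
    moreover have "- laplacian (V_profile s A a) y = c * trunc_power (1 + s) l y - c' * trunc_power (0 + s) l y" for y :: 'a
      using neg_laplacian_V_profile[OF s(1) a l(1), of y]
      by (simp add: l(2) c_def c'_def m_def d_def algebra_simps)
    ultimately have "has_frac_laplacian s (\<lambda>y::'a. - laplacian (V_profile s A a) y) W"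
      by simp
    moreover have "W y = c_const s d a * A - beta_const s d / 2 * (norm y)\<^sup>2" if "y \<in> ball 0 (sqrt l)" for y
    proof -
      have y: "(norm y)\<^sup>2 < l" using that ball by simp
      have "W y = c * (k * (l - g * (norm y)\<^sup>2)) - c' * (k / (1 + s))"
        using frac_trunc_power_0_in_ball[OF s y] frac_trunc_power_1_in_ball[OF s y]
        by (simp add: W_def k_def g_def d_def)
      also have "\<dots> = (2 + s) * a powr (2 + s) * k * (m * (l - g * (norm y)\<^sup>2) - 4 * l)"
        using s by (simp add: c_def c'_def field_simps)
      \<comment> \<open>Here the value of \<open>a\<close> enters: \<open>X\<close> contains
        \<open>2 + s\<close>, \<open>k\<close> and \<open>d + 4 + 2 * s\<close>, the reciprocal of
        \<open>beta_const\<close>, so dividing by \<open>X\<close> leaves this quotient.\<close>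
      also have "(2 + s) * a powr (2 + s) * k = beta_const s d / (2 * g * m)"
        unfolding aX' using s d pos by (simp add: X_def beta_const_def divide_simps) (simp add: algebra_simps)
      \<comment> \<open>The quadratic coefficient is \<open>- beta_const s d / 2\<close> for every
        \<open>l\<close>. The parameter \<open>A = a * l\<close> enters only the constant term, so
        it stays free and determines \<open>C\<close>.\<close>
      also have "beta_const s d / (2 * g * m) * (m * (l - g * (norm y)\<^sup>2) - 4 * l)
        = beta_const s d / (2 * a * g) * (1 - 4 / m) * A - beta_const s d / 2 * (norm y)\<^sup>2"
        using pos a unfolding l(2) by (simp add: field_simps)
      finally show ?thesis by (simp add: c_const_def g_def m_def mu_const_def)
    qed
    moreover have "V_profile s A a y = 0" if "y \<notin> ball 0 (sqrt l)" for y :: 'a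
      using that sign[of y] ball[of y] s by (simp add: V_profile_def)
    moreover have "V_profile s A a y > 0" if "y \<in> ball 0 (sqrt l)" for y :: 'a
      using that sign[of y] ball[of y] by (simp add: V_profile_def)
    ultimately show ?thesis
      unfolding solves_profile_problem_def l_def[symmetric] d_def[symmetric] by blast
  qed
  with a aX show ?thesis
    unfolding X_def g_def m_def k_def by blast
qed

end
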